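(* Let $G$ be a caterpillar graph without isolated vertices (i.e. with at least two vertices), and let $\mathbf{k}$ be the degree-vector of $G$. Then $$\operatorname{reg}(S/\mathrm{NI}_{\mathbf{k}}(G))\le\tau(G)-1.$$
   Context: Let $K$ be a field. For a finite simple graph $G$ on $[n]$ without isolated vertices, $S=K[x_1,\ldots,x_n]$; $N_G[i]$ is the closed neighborhood of $i$; $\mathbf{x}_W=\prod_{j\in W}x_j$. For $\mathbf{k}=(k_1,\ldots,k_n)$ with $1\le k_i\le\deg_G(i)+1$, the $\mathbf{k}$-neighborhood ideal is $\mathrm{NI}_{\mathbf{k}}(G)=\sum_{i=1}^n(\mathbf{x}_W: W\subseteq N_G[i],\ |W|=k_i)\subseteq S$. The degree-vector of $G$ is $\mathbf{k}$ with $k_i=\deg_G(i)$ for all $i$. A caterpillar graph is a tree that has a path $P$ such that every vertex of the tree is either on $P$ or adjacent to a vertex of $P$. $\tau(G)$ is the vertex cover number of $G$. $\operatorname{reg}$ is Castelnuovo-Mumford regularity. *)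

theory Defs
  imports
    "HOL-Library.Poly_Mapping"
    "HOL-Library.Set_Algebras"
    "HOL-Library.Extended_Real"
    "Jordan_Normal_Form.Matrix"
begin

section \<open>Finite simple graphs\<close>

text \<open>A graph on the vertex set \<open>UNIV :: 'v set\<close>, with \<open>'v\<close> a finite type, is given by its set of
  edges, each of which is a two-element set.\<close>

definition simple_graph :: "'v::finite set set \<Rightarrow> bool" where
  "simple_graph E \<longleftrightarrow> (\<forall>e\<in>E. card e = 2)"

definition nbhd :: "'v::finite set set \<Rightarrow> 'v \<Rightarrow> 'v set" where
  "nbhd E i = {j. {i, j} \<in> E}"

definition closed_nbhd :: "'v::finite set set \<Rightarrow> 'v \<Rightarrow> 'v set" where
  "closed_nbhd E i = insert i (nbhd E i)"

definition vertex_degree :: "'v::finite set set \<Rightarrow> 'v \<Rightarrow> nat" where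
  "vertex_degree E i = card (nbhd E i)"

definition no_isolated_vertices :: "'v::finite set set \<Rightarrow> bool" where
  "no_isolated_vertices E \<longleftrightarrow> (\<forall>i. nbhd E i \<noteq> {})"

definition graph_path :: "'v::finite set set \<Rightarrow> 'v list \<Rightarrow> bool" where
  "graph_path E p \<longleftrightarrow> p \<noteq> [] \<and> distinct p \<and> successively (\<lambda>u v. {u, v} \<in> E) p"

definition graph_cycle :: "'v::finite set set \<Rightarrow> 'v list \<Rightarrow> bool" where
  "graph_cycle E c \<longleftrightarrow> graph_path E c \<and> length c \<ge> 3 \<and> {last c, hd c} \<in> E"

definition graph_connected :: "'v::finite set set \<Rightarrow> bool" where
  "graph_connected E \<longleftrightarrow> (\<forall>u v. \<exists>p. graph_path E p \<and> hd p = u \<and> last p = v)"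

definition is_tree :: "'v::finite set set \<Rightarrow> bool" where
  "is_tree E \<longleftrightarrow> graph_connected E \<and> (\<nexists>c. graph_cycle E c)"

definition caterpillar :: "'v::finite set set \<Rightarrow> bool" where
  "caterpillar E \<longleftrightarrow> is_tree E \<and>
     (\<exists>p. graph_path E p \<and> (\<forall>v. v \<in> set p \<or> (\<exists>u\<in>set p. {u, v} \<in> E)))"

definition vertex_cover :: "'v::finite set set \<Rightarrow> 'v set \<Rightarrow> bool" where
  "vertex_cover E C \<longleftrightarrow> (\<forall>e\<in>E. e \<inter> C \<noteq> {})"

definition vertex_cover_number :: "'v::finite set set \<Rightarrow> nat" where
  "vertex_cover_number E = Min (card ` {C. vertex_cover E C})"


section \<open>Polynomials and neighborhood ideals\<close>

text \<open>The polynomial ring \<open>K[x\<^sub>v | v \<in> 'v]\<close>: finitely supported maps from exponent vectors to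
  coefficients, multiplied by convolution.\<close>

type_synonym ('v, 'k) mpoly = "('v \<Rightarrow>\<^sub>0 nat) \<Rightarrow>\<^sub>0 'k"

definition indet :: "'v::finite \<Rightarrow> ('v, 'k::field) mpoly" where
  "indet v = Poly_Mapping.single (Poly_Mapping.single v 1) 1"

definition total_degree :: "('v::finite \<Rightarrow>\<^sub>0 nat) \<Rightarrow> nat" where
  "total_degree m = (\<Sum>v\<in>UNIV. Poly_Mapping.lookup m v)"

text \<open>Only the zero polynomial is homogeneous of negative degree.\<close>

definition homogeneous :: "int \<Rightarrow> ('v::finite, 'k::field) mpoly \<Rightarrow> bool" where
  "homogeneous d p \<longleftrightarrow> (\<forall>m\<in>Poly_Mapping.keys p. int (total_degree m) = d)"

text \<open>The ideals of a commutative ring are the submodules of the ring regarded as a module over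
  itself.\<close>

definition ideal_gen :: "'a::comm_ring_1 set \<Rightarrow> 'a set" where
  "ideal_gen B = Modules.module.span (*) B"

definition irrelevant_ideal :: "('v::finite, 'k::field) mpoly set" where
  "irrelevant_ideal = ideal_gen (range indet)"

text \<open>The outer sum is the sum of ideals, i.e. elementwise addition of sets.\<close>

definition neighborhood_ideal ::
    "('v \<Rightarrow> nat) \<Rightarrow> 'v::finite set set \<Rightarrow> ('v, 'k::field) mpoly set" where
  "neighborhood_ideal k E =
     (\<Sum>i\<in>UNIV. ideal_gen {\<Prod>j\<in>W. indet j | W. W \<subseteq> closed_nbhd E i \<and> card W = k i})"


section \<open>Castelnuovo-Mumford regularity\<close>

text \<open>A minimal graded free resolution
    \<open>\<dots> \<rightarrow> F\<^sub>2 \<rightarrow> F\<^sub>1 \<rightarrow> F\<^sub>0 \<rightarrow> S/I \<rightarrow> 0\<close>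
  of \<open>S/I\<close> for a homogeneous ideal \<open>I\<close>. Here \<open>F\<^sub>i = \<Oplus>\<^bsub>k < r i\<^esub> S(-d i k)\<close> is realised as
  \<open>carrier_vec (r i)\<close> with the \<open>k\<close>-th unit vector in degree \<open>d i k\<close>; the matrix \<open>D i\<close> describes the
  differential from \<open>F\<^sub>i\<^sub>+\<^sub>1\<close> to \<open>F\<^sub>i\<close>, and the augmentation from \<open>F\<^sub>0\<close> to \<open>S/I\<close> sends \<open>x\<close> to the class
  of \<open>e \<bullet> x\<close>. The homogeneity conditions say that these maps are graded of degree zero; they are
  followed by exactness at \<open>S/I\<close>, at \<open>F\<^sub>0\<close> and at \<open>F\<^sub>i\<^sub>+\<^sub>1\<close>, and by minimality.\<close>

definition minimal_graded_free_resolution ::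
    "('v::finite, 'k::field) mpoly set \<Rightarrow> (nat \<Rightarrow> nat) \<Rightarrow> (nat \<Rightarrow> nat \<Rightarrow> int) \<Rightarrow>
     ('v, 'k) mpoly vec \<Rightarrow> (nat \<Rightarrow> ('v, 'k) mpoly mat) \<Rightarrow> bool" where
  "minimal_graded_free_resolution I r d e D \<longleftrightarrow>
     e \<in> carrier_vec (r 0) \<and>
     (\<forall>i. D i \<in> carrier_mat (r i) (r (Suc i))) \<and>
     (\<forall>k<r 0. homogeneous (d 0 k) (e $ k)) \<and>
     (\<forall>i. \<forall>l<r i. \<forall>k<r (Suc i). homogeneous (d (Suc i) k - d i l) (D i $$ (l, k))) \<and>
     (\<forall>p. \<exists>x\<in>carrier_vec (r 0). p - e \<bullet> x \<in> I) \<and>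
     {x \<in> carrier_vec (r 0). e \<bullet> x \<in> I} = (\<lambda>y. D 0 *\<^sub>v y) ` carrier_vec (r 1) \<and>
     (\<forall>i. {x \<in> carrier_vec (r (Suc i)). D i *\<^sub>v x = 0\<^sub>v (r i)} =
            (\<lambda>y. D (Suc i) *\<^sub>v y) ` carrier_vec (r (Suc (Suc i)))) \<and>
     (\<forall>i. \<forall>l<r i. \<forall>k<r (Suc i). D i $$ (l, k) \<in> irrelevant_ideal)"

text \<open>The pairs \<open>(i, j)\<close> with \<open>\<beta>\<^sub>i\<^sub>,\<^sub>j(S/I) \<noteq> 0\<close>. The minimal graded free resolution is unique up to
  isomorphism, so every choice of it contributes the same pairs.\<close>

definition betti_support :: "('v::finite, 'k::field) mpoly set \<Rightarrow> (nat \<times> int) set" where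
  "betti_support I = {(i, j). \<exists>r d e D.
     minimal_graded_free_resolution I r d e D \<and> (\<exists>k<r i. d i k = j)}"

text \<open>\<open>reg (S/I) = sup {j - i | \<beta>\<^sub>i\<^sub>,\<^sub>j(S/I) \<noteq> 0}\<close>, which is \<open>-\<infinity>\<close> for the zero module.\<close>

definition reg_quotient :: "('v::finite, 'k::field) mpoly set \<Rightarrow> ereal" where
  "reg_quotient I = (SUP (i, j)\<in>betti_support I. ereal (real_of_int (j - int i)))"

end

theory Submission
  imports Defs "HOL-Library.Countable"
begin

text \<open>
  Write \<open>I\<close> for the neighborhood ideal and \<open>m\<close> for the irrelevant ideal. The proof bounds the
  regularity by Koszul homology and then computes with monomials.

  From resolutions to Koszul homology. Let \<open>F\<close> be a minimal graded free resolution of \<open>S/I\<close>. A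
  generator of \<open>F\<^sub>i\<close> of degree \<open>d\<close> is not in \<open>m F\<^sub>i\<close>, so it is a nonzero class in degree-zero Koszul
  homology of the \<open>i\<close>-th syzygy module. Dimension shifting along \<open>F\<close> turns it into a nonzero Koszul
  homology class of \<open>S/I\<close> represented by a cycle with coefficients of degree \<open>d - i\<close>. Hence
  \<open>reg (S/I) \<le> \<rho>\<close> once every Koszul cycle modulo \<open>I\<close> with homogeneous coefficients of degree greater
  than \<open>\<rho>\<close> is a boundary modulo \<open>I\<close> (\<open>reg_quotient_le_koszul\<close>). The argument applies to every minimal
  graded free resolution, hence to every Betti number.

  Bounding Koszul homology. For a variable \<open>x\<close> the sequence
  \<open>0 \<rightarrow> S/(I : x)(-1) \<rightarrow> S/I \<rightarrow> S/(I + (x)) \<rightarrow> 0\<close> is exact, so vanishing for \<open>I : x\<close> in degree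
  \<open>c - 1\<close> and for \<open>I + (x)\<close> in degree \<open>c\<close> gives vanishing for \<open>I\<close> in degree \<open>c\<close>
  (\<open>koszul_vanishing_colon_sum\<close>). The recursion ends at ideals generated by variables, whose Koszul
  homology has constant coefficients (\<open>koszul_vanishing_variables\<close>).

  The combinatorics. Call a vertex inner if it is neither a leaf nor adjacent to a leaf. The
  variables of all other vertices lie in \<open>I\<close>. In a caterpillar an inner vertex lies on the spine and
  its only neighbors are the preceding and the following spine vertex, so \<open>I\<close> is generated by the
  variables of the vertices that are not inner and by the products \<open>x\<^sub>u x\<^sub>v\<close> of two vertices in a
  common closed neighborhood of an inner vertex (\<open>nbhd_mons_degree\<close>). Kill vertices one at a time:
  let \<open>u\<close> be the first surviving vertex along the spine that has a partner, and \<open>x\<close> such a partner,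
  which is at most two steps further. Adding \<open>x\<close> kills \<open>x\<close>. Passing to the colon ideal kills all
  partners of \<open>x\<close>, so afterwards every vertex with a partner is at least two steps beyond \<open>u\<close>. The
  spine edge starting at \<open>u\<close> has two inner ends, and a vertex cover \<open>C\<close> contains one of them; each
  colon step therefore uses up an element of \<open>C\<close>, and the regularity is at most the number of inner
  vertices in \<open>C\<close> (\<open>koszul_reg_le_caterpillar\<close>). Finally an edge at a leaf has no inner end, so \<open>C\<close>
  has at least one element more (\<open>vertex_cover_not_inner\<close>). Taking \<open>C\<close> minimal gives the bound.
\<close>

section \<open>Monomials and homogeneous polynomials\<close>

abbreviation var_mon :: "'v \<Rightarrow> ('v \<Rightarrow>\<^sub>0 nat)" where
  "var_mon v \<equiv> Poly_Mapping.single v (Suc 0)"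

lemma lookup_indet_times_add:
  "Poly_Mapping.lookup (indet v * p) (var_mon v + a) = Poly_Mapping.lookup p a"
proof -
  have "Poly_Mapping.lookup (indet v * p) (var_mon v + a)
      = (\<Sum>l\<in>{var_mon v}. \<Sum>q\<in>{a}. 1 * Poly_Mapping.lookup p q)"
    unfolding lookup_mult indet_def
    by (simp add: lookup_single when_mult Sum_any_when_equal)
  thus ?thesis by simp
qed

lemma lookup_indet_times_eq_0:
  assumes "Poly_Mapping.lookup a v = 0"
  shows "Poly_Mapping.lookup (indet v * p) a = 0"
proof (rule ccontr)
  assume "Poly_Mapping.lookup (indet v * p) a \<noteq> 0"
  hence "a \<in> Poly_Mapping.keys (indet v * p)" by (simp add: in_keys_iff)
  then obtain b c where "a = b + c" "b \<in> Poly_Mapping.keys (indet v :: ('a, 'b) mpoly)"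
    using keys_mult[of "indet v :: ('a, 'b) mpoly" p] by blast
  with assms show False by (auto simp: indet_def lookup_add lookup_single)
qed

lemma mon_split:
  assumes "Poly_Mapping.lookup a v > 0"
  obtains b where "a = var_mon v + b"
proof -
  have "a = var_mon v + (a - var_mon v)"
    by (rule poly_mapping_eqI) (use assms in \<open>auto simp: lookup_add lookup_minus lookup_single when_def\<close>)
  thus thesis by (rule that)
qed

text \<open>Division by \<open>x\<^sub>v\<close> that discards the monomials not divisible by \<open>x\<^sub>v\<close>: a linear left inverse of
  multiplication by \<open>x\<^sub>v\<close> that commutes with the other variables. It makes contractions of the Koszul
  complex explicit.\<close>

definition indet_quot :: "'v::finite \<Rightarrow> ('v, 'k::field) mpoly \<Rightarrow> ('v, 'k) mpoly" where
  "indet_quot v = Poly_Mapping.map_key (\<lambda>a. var_mon v + a)"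

lemma lookup_indet_quot:
  "Poly_Mapping.lookup (indet_quot v p) a = Poly_Mapping.lookup p (var_mon v + a)"
  unfolding indet_quot_def by (subst map_key.rep_eq) (auto simp: inj_def)

lemma indet_quot_add: "indet_quot v (p + q) = indet_quot v p + indet_quot v q"
  by (rule poly_mapping_eqI) (simp add: lookup_indet_quot lookup_add)

lemma indet_quot_sum: "indet_quot v (sum f A) = (\<Sum>x\<in>A. indet_quot v (f x))"
  by (rule poly_mapping_eqI) (simp add: lookup_indet_quot lookup_sum)

lemma indet_quot_uminus: "indet_quot v (- p) = - indet_quot v p"
  by (rule poly_mapping_eqI) (simp add: lookup_indet_quot)

lemma indet_quot_times_indet: "indet_quot v (indet v * p) = p"
  by (rule poly_mapping_eqI) (simp add: lookup_indet_quot lookup_indet_times_add)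

lemma indet_quot_times_other:
  assumes "u \<noteq> v"
  shows "indet_quot v (indet u * p) = indet u * indet_quot v p"
proof (rule poly_mapping_eqI)
  fix a
  show "Poly_Mapping.lookup (indet_quot v (indet u * p)) a
      = Poly_Mapping.lookup (indet u * indet_quot v p) a"
  proof (cases "Poly_Mapping.lookup a u = 0")
    case True
    with assms show ?thesis
      by (simp add: lookup_indet_quot lookup_indet_times_eq_0 lookup_add lookup_single)
  next
    case False
    then obtain b where b: "a = var_mon u + b" by (auto elim: mon_split[of a u])
    have "var_mon v + a = var_mon u + (var_mon v + b)" by (simp add: b ac_simps)
    hence "Poly_Mapping.lookup (indet_quot v (indet u * p)) a
        = Poly_Mapping.lookup p (var_mon v + b)"
      by (simp only: lookup_indet_quot lookup_indet_times_add)
    thus ?thesis by (simp add: b lookup_indet_times_add lookup_indet_quot)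
  qed
qed

lemma total_degree_add: "total_degree (a + b) = total_degree a + total_degree b"
  by (simp add: total_degree_def lookup_add sum.distrib)

lemma total_degree_var_mon [simp]: "total_degree (var_mon v) = 1"
  by (simp add: total_degree_def lookup_single when_def)

lemma total_degree_eq_0_iff: "total_degree a = 0 \<longleftrightarrow> a = 0"
  by (auto simp: total_degree_def intro: poly_mapping_eqI)

lemma homogeneous_0 [simp]: "homogeneous d 0"
  by (simp add: homogeneous_def)

lemma homogeneous_add: "homogeneous d p \<Longrightarrow> homogeneous d q \<Longrightarrow> homogeneous d (p + q)"
  using keys_add[of p q] by (auto simp: homogeneous_def)

lemma homogeneous_uminus: "homogeneous d p \<Longrightarrow> homogeneous d (- p)"
  by (auto simp: homogeneous_def)

lemma homogeneous_diff: "homogeneous d p \<Longrightarrow> homogeneous d q \<Longrightarrow> homogeneous d (p - q)"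
  using homogeneous_add[of d p "- q"] homogeneous_uminus[of d q] by simp

lemma homogeneous_sum: "(\<And>x. x \<in> A \<Longrightarrow> homogeneous d (f x)) \<Longrightarrow> homogeneous d (sum f A)"
  by (induction A rule: infinite_finite_induct) (auto intro: homogeneous_add)

lemma homogeneous_mult:
  "homogeneous c p \<Longrightarrow> homogeneous d q \<Longrightarrow> homogeneous (c + d) (p * q)"
  unfolding homogeneous_def
proof
  fix m assume *: "\<forall>m\<in>Poly_Mapping.keys p. int (total_degree m) = c"
    "\<forall>m\<in>Poly_Mapping.keys q. int (total_degree m) = d" and "m \<in> Poly_Mapping.keys (p * q)"
  then obtain a b where "m = a + b" "a \<in> Poly_Mapping.keys p" "b \<in> Poly_Mapping.keys q"
    using keys_mult[of p q] by blast
  thus "int (total_degree m) = c + d" using * by (simp add: total_degree_add)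
qed

lemma homogeneous_indet: "homogeneous 1 (indet v)"
  by (simp add: homogeneous_def indet_def)

lemma homogeneous_indet_times: "homogeneous (d - 1) p \<Longrightarrow> homogeneous d (indet v * p)"
  using homogeneous_mult[OF homogeneous_indet, of "d - 1" p v] by simp

lemma homogeneous_indet_quot: "homogeneous d p \<Longrightarrow> homogeneous (d - 1) (indet_quot v p)"
  unfolding homogeneous_def
proof
  fix a assume *: "\<forall>m\<in>Poly_Mapping.keys p. int (total_degree m) = d"
    and "a \<in> Poly_Mapping.keys (indet_quot v p)"
  hence "int (total_degree (var_mon v + a)) = d"
    by (intro *[rule_format]) (simp add: in_keys_iff lookup_indet_quot)
  thus "int (total_degree a) = d - 1" by (simp add: total_degree_add)
qed

section \<open>Monomial ideals\<close>

text \<open>A monomial ideal is represented by the set of exponent vectors of its monomials, so that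
  membership can be tested coefficientwise. It is an ideal when \<open>M\<close> satisfies \<open>mult_closed\<close>.\<close>

definition mon_ideal :: "('v \<Rightarrow>\<^sub>0 nat) set \<Rightarrow> ('v::finite, 'k::field) mpoly set" where
  "mon_ideal M = {p. Poly_Mapping.keys p \<subseteq> M}"

definition mult_closed :: "('v \<Rightarrow>\<^sub>0 nat) set \<Rightarrow> bool" where
  "mult_closed M \<longleftrightarrow> (\<forall>a\<in>M. \<forall>b. a + b \<in> M)"

lemma mon_ideal_iff: "p \<in> mon_ideal M \<longleftrightarrow> (\<forall>a. a \<notin> M \<longrightarrow> Poly_Mapping.lookup p a = 0)"
  by (auto simp: mon_ideal_def in_keys_iff)

lemma mon_ideal_0 [simp]: "0 \<in> mon_ideal M"
  by (simp add: mon_ideal_def)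

lemma mon_ideal_add: "p \<in> mon_ideal M \<Longrightarrow> q \<in> mon_ideal M \<Longrightarrow> p + q \<in> mon_ideal M"
  by (simp add: mon_ideal_iff lookup_add)

lemma mon_ideal_diff: "p \<in> mon_ideal M \<Longrightarrow> q \<in> mon_ideal M \<Longrightarrow> p - q \<in> mon_ideal M"
  by (simp add: mon_ideal_iff lookup_minus)

lemma mon_ideal_uminus: "p \<in> mon_ideal M \<Longrightarrow> - p \<in> mon_ideal M"
  by (simp add: mon_ideal_iff)

lemma mon_ideal_sum: "(\<And>x. x \<in> A \<Longrightarrow> f x \<in> mon_ideal M) \<Longrightarrow> sum f A \<in> mon_ideal M"
  by (induction A rule: infinite_finite_induct) (auto intro: mon_ideal_add)

lemma mon_ideal_mult:
  assumes "mult_closed M" "q \<in> mon_ideal M"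
  shows "p * q \<in> mon_ideal M"
  unfolding mon_ideal_def
proof safe
  fix m assume "m \<in> Poly_Mapping.keys (p * q)"
  then obtain a b where "m = b + a" "b \<in> Poly_Mapping.keys q"
    using keys_mult[of p q] by (auto simp: add.commute)
  thus "m \<in> M" using assms by (auto simp: mon_ideal_def mult_closed_def)
qed

section \<open>The Koszul complex\<close>

text \<open>An element of the Koszul complex is a family of coefficients \<open>w T\<close>, one for each set \<open>T\<close> of
  vertices; \<open>T\<close> stands for the exterior product of its elements in increasing order. All homological
  degrees are treated at once, because the differential lowers \<open>card T\<close> by one and so respects the
  splitting into homological degrees. The order on the vertices is an arbitrary one, supplied by
  \<^const>\<open>to_nat\<close>, and enters only through the signs.\<close>

definition kos_sign :: "'v::finite \<Rightarrow> 'v set \<Rightarrow> 'a::comm_ring_1" where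
  "kos_sign v T = (- 1) ^ card {u \<in> T. to_nat u < to_nat v}"

definition kos_diff :: "('v::finite set \<Rightarrow> ('v, 'k::field) mpoly) \<Rightarrow> 'v set \<Rightarrow> ('v, 'k) mpoly" where
  "kos_diff w T = (\<Sum>v\<in>- T. kos_sign v T * (indet v * w (insert v T)))"

lemma kos_sign_square [simp]: "kos_sign v T * kos_sign v T = 1"
  by (simp add: kos_sign_def flip: power_add mult_2)

lemma kos_sign_cases: "kos_sign v T = (1 :: 'a::comm_ring_1) \<or> kos_sign v T = (- 1 :: 'a)"
  unfolding kos_sign_def by (metis minus_one_power_iff)

lemma kos_sign_mult_square [simp]: "kos_sign v T * (kos_sign v T * p) = p"
  by (simp flip: mult.assoc)

text \<open>Of two different vertices exactly one precedes the other, so exactly one of the two signs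
  changes when the other vertex is added to the set.\<close>

lemma kos_sign_swap:
  assumes "u \<noteq> v" "u \<notin> T" "v \<notin> T"
  shows "kos_sign u (insert v T) * kos_sign v (insert u T)
       = - (kos_sign u T * kos_sign v T :: 'a::comm_ring_1)"
proof -
  have *: "kos_sign u (insert v T) * kos_sign v (insert u T)
       = - (kos_sign u T * kos_sign v T :: 'a)"
    if "to_nat u < to_nat v" "u \<notin> T" for u v :: 'b
  proof -
    have "{x \<in> insert v T. to_nat x < to_nat u} = {x \<in> T. to_nat x < to_nat u}"
      "{x \<in> insert u T. to_nat x < to_nat v} = insert u {x \<in> T. to_nat x < to_nat v}"
      using that by auto
    with that show ?thesis by (simp add: kos_sign_def)
  qed
  show ?thesis
  proof (cases "to_nat u < to_nat v")
    case True
    with * assms show ?thesis by blast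
  next
    case False
    with assms have "to_nat v < to_nat u" by (metis linorder_less_linear to_nat_split)
    from *[OF this] assms show ?thesis by (simp add: mult.commute)
  qed
qed

lemma kos_sign_swap':
  assumes "u \<noteq> v" "u \<notin> T" "v \<notin> T"
  shows "kos_sign v T * kos_sign u (insert v T)
       = - (kos_sign u T * kos_sign v (insert u T) :: 'a::comm_ring_1)"
proof -
  have "kos_sign v T * kos_sign u (insert v T)
      = (kos_sign u (insert v T) * kos_sign v (insert u T)) * (kos_sign v T * kos_sign v (insert u T) :: 'a)"
    by (simp add: ac_simps)
  also have "\<dots> = - (kos_sign u T * kos_sign v (insert u T))"
    by (subst kos_sign_swap[OF assms]) (simp add: ac_simps)
  finally show ?thesis .
qed

lemma kos_diff_add: "kos_diff (\<lambda>T. w T + w' T) T = kos_diff w T + kos_diff w' T"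
  by (simp add: kos_diff_def algebra_simps sum.distrib)

lemma kos_diff_diff: "kos_diff (\<lambda>T. w T - w' T) T = kos_diff w T - kos_diff w' T"
  by (simp add: kos_diff_def algebra_simps sum_subtractf)

lemma kos_diff_mult: "kos_diff (\<lambda>T. p * w T) T = p * kos_diff w T"
  by (simp add: kos_diff_def sum_distrib_left ac_simps)

lemma kos_diff_0 [simp]: "kos_diff (\<lambda>T. 0) T = 0"
  by (simp add: kos_diff_def)

lemma kos_diff_sum: "kos_diff (\<lambda>T. \<Sum>k\<in>A. w k T) T = (\<Sum>k\<in>A. kos_diff (w k) T)"
  by (induction A rule: infinite_finite_induct) (simp_all add: kos_diff_add)

text \<open>The terms for \<open>(v, u)\<close> and \<open>(u, v)\<close> cancel. They are paired through the two halves \<open>P\<close> and \<open>Q\<close> of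
  the off-diagonal, since in characteristic two it is not enough that the sum equals its own
  negative.\<close>

lemma kos_diff_kos_diff [simp]: "kos_diff (kos_diff w) T = (0 :: ('v::finite, 'k::field) mpoly)"
proof -
  define g :: "'v \<times> 'v \<Rightarrow> ('v, 'k) mpoly" where
    "g = (\<lambda>(v, u). kos_sign v T * kos_sign u (insert v T) * (indet v * indet u * w (insert u (insert v T))))"
  define P where "P = {(v, u). v \<notin> T \<and> u \<notin> T \<and> to_nat v < to_nat u}"
  define Q where "Q = {(v, u). v \<notin> T \<and> u \<notin> T \<and> to_nat u < to_nat v}"
  have PQ: "Sigma (- T) (\<lambda>v. - insert v T) = P \<union> Q" "P \<inter> Q = {}"
    by (auto simp: P_def Q_def not_less le_less)
  have "kos_diff (kos_diff w) T = (\<Sum>v\<in>- T. \<Sum>u\<in>- insert v T. g (v, u))"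
    unfolding kos_diff_def g_def by (simp add: sum_distrib_left ac_simps)
  also have "\<dots> = sum g (P \<union> Q)"
    by (subst sum.Sigma) (auto simp: PQ simp flip: Compl_insert)
  also have "\<dots> = sum g P + sum g Q"
    by (rule sum.union_disjoint) (auto simp: PQ)
  also have "sum g Q = (\<Sum>x\<in>P. - g x)"
  proof (rule sum.reindex_bij_witness[where i = prod.swap and j = prod.swap])
    fix x assume "x \<in> Q"
    then obtain v u where x: "x = (v, u)" "v \<notin> T" "u \<notin> T" "u \<noteq> v"
      by (auto simp: Q_def)
    show "- g (prod.swap x) = g x"
      using x by (simp add: g_def kos_sign_swap'[of u v T] insert_commute mult.commute[of "indet u"])
  qed (auto simp: P_def Q_def)
  finally show ?thesis by (simp add: sum_negf)
qed

lemma mon_ideal_kos_sign: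
  fixes p :: "('v::finite, 'k::field) mpoly"
  shows "p \<in> mon_ideal M \<Longrightarrow> kos_sign v T * p \<in> mon_ideal M"
  using kos_sign_cases[of v T, where 'a = "('v, 'k) mpoly"] by (auto intro: mon_ideal_uminus)

lemma homogeneous_kos_sign:
  fixes p :: "('v::finite, 'k::field) mpoly"
  shows "homogeneous d p \<Longrightarrow> homogeneous d (kos_sign v T * p)"
  using kos_sign_cases[of v T, where 'a = "('v, 'k) mpoly"] by (auto intro: homogeneous_uminus)

lemma mon_ideal_kos_diff:
  "mult_closed M \<Longrightarrow> (\<And>T. w T \<in> mon_ideal M) \<Longrightarrow> kos_diff w T \<in> mon_ideal M"
  unfolding kos_diff_def by (intro mon_ideal_sum mon_ideal_kos_sign mon_ideal_mult)

lemma homogeneous_kos_diff: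
  "(\<And>T. homogeneous (c - 1) (w T)) \<Longrightarrow> homogeneous c (kos_diff w T)"
  unfolding kos_diff_def by (intro homogeneous_sum homogeneous_kos_sign homogeneous_indet_times)


lemma indet_quot_kos_sign:
  fixes p :: "('v::finite, 'k::field) mpoly"
  shows "indet_quot v (kos_sign u T * p) = kos_sign u T * indet_quot v p"
  using kos_sign_cases[of u T, where 'a = "('v, 'k) mpoly"] by (auto simp: indet_quot_uminus)

text \<open>Exterior multiplication by \<open>v\<close> combined with division by \<open>x\<^sub>v\<close>.\<close>

definition kos_homotopy ::
    "'v::finite \<Rightarrow> ('v set \<Rightarrow> ('v, 'k::field) mpoly) \<Rightarrow> 'v set \<Rightarrow> ('v, 'k) mpoly" where
  "kos_homotopy v w T =
     (if v \<in> T then kos_sign v (T - {v}) * indet_quot v (w (T - {v})) else 0)"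

text \<open>The homotopy connects the identity with the projection onto the elements that involve the vertex
  \<open>v\<close> neither in \<open>T\<close> nor in a coefficient. Treating one variable at a time avoids the usual Euler
  homotopy, which divides by the degree and fails in positive characteristic.\<close>

lemma kos_homotopy_identity:
  fixes w :: "'v::finite set \<Rightarrow> ('v, 'k::field) mpoly"
  shows "w T = kos_diff (kos_homotopy v w) T + kos_homotopy v (kos_diff w) T
     + (if v \<in> T then 0 else w T - indet v * indet_quot v (w T))"
proof (cases "v \<in> T")
  case False
  have "kos_diff (kos_homotopy v w) T
      = (\<Sum>u\<in>-T. if u = v then indet v * indet_quot v (w T) else 0)"
    unfolding kos_diff_def kos_homotopy_def
    by (rule sum.cong) (use False in \<open>auto simp: mult.left_commute[of "indet v"]\<close>)
  also have "\<dots> = indet v * indet_quot v (w T)" using False by simp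
  finally show ?thesis using False by (simp add: kos_homotopy_def)
next
  case True
  define T' where "T' = T - {v}"
  have T: "T = insert v T'" "v \<notin> T'" using True by (auto simp: T'_def)
  define g where "g u = kos_sign v T' * (kos_sign u T' * (indet u * indet_quot v (w (insert u T'))))" for u
  have "kos_diff (kos_homotopy v w) T = (\<Sum>u\<in>-T. - g u)"
    unfolding kos_diff_def
  proof (rule sum.cong)
    fix u assume "u \<in> - T"
    hence u: "u \<noteq> v" "u \<notin> T'" and e: "insert u T - {v} = insert u T'" using T by auto
    have "kos_sign u T * (indet u * kos_homotopy v w (insert u T))
       = (kos_sign u (insert v T') * kos_sign v (insert u T')) * (indet u * indet_quot v (w (insert u T')))"
      using True by (simp add: kos_homotopy_def e ac_simps flip: T(1))
    also have "\<dots> = - g u"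
      by (subst kos_sign_swap[OF u T(2)]) (simp add: g_def ac_simps)
    finally show "kos_sign u T * (indet u * kos_homotopy v w (insert u T)) = - g u" .
  qed simp
  moreover have "kos_homotopy v (kos_diff w) T = w T + (\<Sum>u\<in>-T. g u)"
  proof -
    have "- T' = insert v (- T)" using T by auto
    hence "kos_diff w T' = kos_sign v T' * (indet v * w T)
        + (\<Sum>u\<in>-T. kos_sign u T' * (indet u * w (insert u T')))"
      unfolding kos_diff_def using T by simp
    hence "kos_homotopy v (kos_diff w) T = w T
        + kos_sign v T' * indet_quot v (\<Sum>u\<in>-T. kos_sign u T' * (indet u * w (insert u T')))"
      using True by (simp add: kos_homotopy_def indet_quot_add indet_quot_kos_sign
          indet_quot_times_indet distrib_left flip: T'_def)
    also have "indet_quot v (\<Sum>u\<in>-T. kos_sign u T' * (indet u * w (insert u T')))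
        = (\<Sum>u\<in>-T. kos_sign u T' * (indet u * indet_quot v (w (insert u T'))))"
      unfolding indet_quot_sum
    proof (rule sum.cong)
      fix u assume "u \<in> - T"
      hence "u \<noteq> v" using T by auto
      thus "indet_quot v (kos_sign u T' * (indet u * w (insert u T')))
          = kos_sign u T' * (indet u * indet_quot v (w (insert u T')))"
        by (simp add: indet_quot_kos_sign indet_quot_times_other)
    qed simp
    finally show ?thesis by (simp add: g_def sum_distrib_left)
  qed
  ultimately show ?thesis using True by (simp add: sum_negf)
qed

section \<open>Vanishing of Koszul homology\<close>

text \<open>Vanishing of the Koszul homology of \<open>S/I\<close> in coefficient degree \<open>c\<close>. A generator \<open>T\<close> has degree
  \<open>card T\<close>, so \<open>c\<close> is the internal degree minus the homological degree, the very difference that the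
  regularity measures.\<close>

definition koszul_vanishing :: "('v::finite, 'k::field) mpoly set \<Rightarrow> int \<Rightarrow> bool" where
  "koszul_vanishing I c \<longleftrightarrow>
     (\<forall>w. (\<forall>T. homogeneous c (w T)) \<and> (\<forall>T. kos_diff w T \<in> I) \<longrightarrow>
        (\<exists>u. (\<forall>T. homogeneous (c - 1) (u T)) \<and> (\<forall>T. w T - kos_diff u T \<in> I)))"

lemma koszul_vanishingE:
  assumes "koszul_vanishing I c" "\<And>T. homogeneous c (w T)" "\<And>T. kos_diff w T \<in> I"
  obtains u where "\<And>T. homogeneous (c - 1) (u T)" "\<And>T. w T - kos_diff u T \<in> I"
  using assms unfolding koszul_vanishing_def by metis

text \<open>The monomials of the ideal generated by the variables outside \<open>V\<close>. For \<open>V = {}\<close> this is the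
  irrelevant ideal, for \<open>V = UNIV\<close> the zero ideal.\<close>

definition off_mons :: "'v set \<Rightarrow> ('v \<Rightarrow>\<^sub>0 nat) set" where
  "off_mons V = {a. \<exists>z. z \<notin> V \<and> Poly_Mapping.lookup a z > 0}"

lemma mult_closed_off_mons: "mult_closed (off_mons V)"
  by (auto simp: mult_closed_def off_mons_def lookup_add)

text \<open>Since \<open>x\<^sub>v\<close> with \<open>v \<in> V\<close> acts on \<open>S/I\<close> as on a polynomial ring, the homotopies of these variables
  respect \<open>I\<close>. Applying them in turn makes a cycle homologous to one whose coefficients contain no
  variable of \<open>V\<close>. A monomial of positive degree without variables of \<open>V\<close> lies in \<open>I\<close>.\<close>

lemma koszul_vanishing_variables:
  fixes V :: "'v::finite set"
  assumes "c \<ge> 1"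
  shows "koszul_vanishing (mon_ideal (off_mons V) :: ('v, 'k::field) mpoly set) c"
  unfolding koszul_vanishing_def
proof (intro allI impI, elim conjE)
  let ?I = "mon_ideal (off_mons V) :: ('v, 'k) mpoly set"
  fix w :: "'v set \<Rightarrow> ('v, 'k) mpoly"
  assume w: "\<forall>T. homogeneous c (w T)" "\<forall>T. kos_diff w T \<in> ?I"
  have quot: "indet_quot v p \<in> ?I" if "p \<in> ?I" "v \<in> V" for v p
  proof -
    have "var_mon v + a \<notin> off_mons V" if "a \<notin> off_mons V" for a
      using that \<open>v \<in> V\<close> by (auto simp: off_mons_def lookup_add lookup_single when_def)
    with that(1) show ?thesis by (simp add: mon_ideal_iff lookup_indet_quot)
  qed
  \<comment> \<open>\<open>u\<close> is the boundary subtracted so far, \<open>m\<close> an error in the ideal, and \<open>r\<close> the remaining cycle,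
      free of the variables in \<open>X\<close>.\<close>
  define reduced where "reduced X u m r \<longleftrightarrow>
      (\<forall>T. homogeneous (c - 1) (u T)) \<and> (\<forall>T. m T \<in> ?I) \<and> (\<forall>T. homogeneous c (r T))
      \<and> (\<forall>T. w T - kos_diff u T = m T + r T)
      \<and> (\<forall>T. \<forall>a\<in>Poly_Mapping.keys (r T). \<forall>x\<in>X. Poly_Mapping.lookup a x = 0)" for X u m r
  have "\<exists>u m r. reduced X u m r"
    if "X \<subseteq> V" for X
    using finite[of X] that
  proof (induction X rule: finite_induct)
    case empty
    show ?case
      by (rule exI[of _ "\<lambda>T. 0"], rule exI[of _ "\<lambda>T. 0"], rule exI[of _ w])
        (simp add: w(1) reduced_def)
  next
    case (insert v X)
    hence "v \<in> V" "X \<subseteq> V" by simp_all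
    from insert.IH[OF \<open>X \<subseteq> V\<close>] obtain u m r where
      "reduced X u m r" by blast
    hence u: "\<And>T. homogeneous (c - 1) (u T)" and m: "\<And>T. m T \<in> ?I"
      and r: "\<And>T. homogeneous c (r T)" and eq: "\<And>T. w T - kos_diff u T = m T + r T"
      and keys: "\<And>T a x. a \<in> Poly_Mapping.keys (r T) \<Longrightarrow> x \<in> X \<Longrightarrow> Poly_Mapping.lookup a x = 0"
      by (simp_all add: reduced_def)
    define r' where "r' T = (if v \<in> T then 0 else r T - indet v * indet_quot v (r T))" for T
    define m' where "m' T = m T + kos_homotopy v (kos_diff r) T" for T
    define u' where "u' T = u T + kos_homotopy v r T" for T
    have "kos_diff r T \<in> ?I" for T
    proof -
      have "r = (\<lambda>T. (w T - kos_diff u T) - m T)" by (simp add: eq)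
      hence "kos_diff r T = kos_diff (\<lambda>T. (w T - kos_diff u T) - m T) T" by (rule arg_cong[where f = "\<lambda>r. kos_diff r T"])
      also have "\<dots> = kos_diff w T - kos_diff m T" by (simp add: kos_diff_diff)
      finally have "kos_diff r T = kos_diff w T - kos_diff m T" .
      thus ?thesis using w m by (simp add: mon_ideal_diff mon_ideal_kos_diff mult_closed_off_mons)
    qed
    hence m': "m' T \<in> ?I" for T
      by (simp add: m'_def kos_homotopy_def m mon_ideal_add mon_ideal_kos_sign quot \<open>v \<in> V\<close>)
    have u': "homogeneous (c - 1) (u' T)" for T
      by (simp add: u'_def kos_homotopy_def u r homogeneous_add homogeneous_kos_sign
          homogeneous_indet_quot)
    have r': "homogeneous c (r' T)" for T
      by (simp add: r'_def r homogeneous_diff homogeneous_indet_times homogeneous_indet_quot)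
    have eq': "w T - kos_diff u' T = m' T + r' T" for T
    proof -
      have "kos_diff u' T = kos_diff u T + kos_diff (kos_homotopy v r) T"
        unfolding u'_def by (rule kos_diff_add)
      with eq[of T] kos_homotopy_identity[of r T v] show ?thesis
        unfolding m'_def r'_def by (simp add: algebra_simps)
    qed
    have keys': "Poly_Mapping.lookup a x = 0" if a: "a \<in> Poly_Mapping.keys (r' T)" and x: "x \<in> insert v X" for T a x
    proof -
      have T: "v \<notin> T" using a by (auto simp: r'_def split: if_splits)
      hence nz: "Poly_Mapping.lookup (r T - indet v * indet_quot v (r T)) a \<noteq> 0"
        using a by (simp add: r'_def in_keys_iff)
      have av: "Poly_Mapping.lookup a v = 0"
      proof (rule ccontr)
        assume "Poly_Mapping.lookup a v \<noteq> 0"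
        then obtain b where "a = var_mon v + b" by (auto elim: mon_split[of a v])
        with nz show False by (simp add: lookup_minus lookup_indet_times_add lookup_indet_quot)
      qed
      hence "a \<in> Poly_Mapping.keys (r T)"
        using nz by (simp add: lookup_minus lookup_indet_times_eq_0 in_keys_iff)
      from keys[OF this] x av show ?thesis by (cases "x = v") simp_all
    qed
    show ?case
      by (rule exI[of _ u'], rule exI[of _ m'], rule exI[of _ r'])
        (unfold reduced_def, intro conjI allI ballI u' m' r' eq' keys')
  qed
  from this[OF subset_refl] obtain u m r where
    "reduced V u m r" by blast
  hence u: "\<And>T. homogeneous (c - 1) (u T)" and m: "\<And>T. m T \<in> ?I"
    and r: "\<And>T. homogeneous c (r T)" and eq: "\<And>T. w T - kos_diff u T = m T + r T"
    and keys: "\<And>T a x. a \<in> Poly_Mapping.keys (r T) \<Longrightarrow> x \<in> V \<Longrightarrow> Poly_Mapping.lookup a x = 0"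
    by (simp_all add: reduced_def)
  have "r T \<in> ?I" for T
    unfolding mon_ideal_def
  proof safe
    fix a assume a: "a \<in> Poly_Mapping.keys (r T)"
    with r[of T] have "int (total_degree a) = c" unfolding homogeneous_def by blast
    with \<open>c \<ge> 1\<close> have "total_degree a \<noteq> 0" by linarith
    then obtain z where z: "Poly_Mapping.lookup a z \<noteq> 0"
      unfolding total_degree_def by (meson sum.neutral)
    hence "z \<notin> V" using keys[OF a, of z] by metis
    with z show "a \<in> off_mons V" unfolding off_mons_def by blast
  qed
  with u m eq show "\<exists>u. (\<forall>T. homogeneous (c - 1) (u T)) \<and> (\<forall>T. w T - kos_diff u T \<in> ?I)"
    by (intro exI[of _ u]) (simp add: mon_ideal_add)
qed

text \<open>The middle part of the long exact sequence, carried out on elements. A cycle \<open>w\<close> modulo \<open>M\<close> is a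
  boundary modulo \<open>M\<close> and \<open>x\<close>, up to a remainder \<open>x y\<close>; then \<open>y\<close> is a cycle modulo the colon ideal with
  coefficients of degree one less, hence a boundary there.\<close>

lemma koszul_vanishing_colon_sum:
  fixes M :: "('v::finite \<Rightarrow>\<^sub>0 nat) set" and c :: int
  assumes M: "mult_closed M"
    and colon: "koszul_vanishing (mon_ideal {a. var_mon x + a \<in> M} :: ('v, 'k::field) mpoly set) (c - 1)"
    and plus: "koszul_vanishing (mon_ideal (M \<union> {a. Poly_Mapping.lookup a x > 0}) :: ('v, 'k) mpoly set) c"
  shows "koszul_vanishing (mon_ideal M :: ('v, 'k) mpoly set) c"
  unfolding koszul_vanishing_def
proof (intro allI impI, elim conjE)
  fix w :: "'v set \<Rightarrow> ('v, 'k) mpoly"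
  assume w: "\<forall>T. homogeneous c (w T)" "\<forall>T. kos_diff w T \<in> mon_ideal M"
  let ?M = "M \<union> {a. Poly_Mapping.lookup a x > 0}"
  have "kos_diff w T \<in> mon_ideal ?M" for T using w(2) by (auto simp: mon_ideal_def)
  with plus w(1)[rule_format] obtain u where u: "\<And>T. homogeneous (c - 1) (u T)"
    and wu: "\<And>T. w T - kos_diff u T \<in> mon_ideal ?M"
    by (rule koszul_vanishingE) (rule that)
  define r where "r T = w T - kos_diff u T" for T
  have r: "r T \<in> mon_ideal ?M" "homogeneous c (r T)" for T
    using wu w(1) by (simp_all add: r_def homogeneous_diff homogeneous_kos_diff u)
  \<comment> \<open>The part of \<open>r T\<close> outside the ideal; each of its monomials is divisible by \<open>x\<close>.\<close>
  define n where "n T = Poly_Mapping.mapp (\<lambda>a k. if a \<in> M then 0 else k) (r T)" for T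
  have n: "Poly_Mapping.lookup (n T) a = (if a \<in> M then 0 else Poly_Mapping.lookup (r T) a)" for T a
    by (simp add: n_def lookup_mapp when_def in_keys_iff)
  have hn: "homogeneous c (n T)" for T
    using r(2)[of T] by (auto simp: homogeneous_def in_keys_iff n split: if_splits)
  define y where "y T = indet_quot x (n T)" for T
  have xy: "indet x * y T = n T" for T
  proof (rule poly_mapping_eqI)
    fix a
    show "Poly_Mapping.lookup (indet x * y T) a = Poly_Mapping.lookup (n T) a"
    proof (cases "Poly_Mapping.lookup a x = 0")
      case True
      thus ?thesis using r(1)[of T] by (auto simp: lookup_indet_times_eq_0 n mon_ideal_iff)
    next
      case False
      then obtain b where "a = var_mon x + b" by (auto elim: mon_split[of a x])
      thus ?thesis by (simp add: lookup_indet_times_add y_def lookup_indet_quot)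
    qed
  qed
  have m: "r T - indet x * y T \<in> mon_ideal M" for T
    by (simp add: xy mon_ideal_iff lookup_minus n)
  have hy: "homogeneous (c - 1) (y T)" for T
    unfolding y_def by (intro homogeneous_indet_quot hn)
  have colon_iff: "p \<in> mon_ideal {a. var_mon x + a \<in> M} \<longleftrightarrow> indet x * p \<in> mon_ideal M"
    for p :: "('v, 'k) mpoly"
  proof
    assume p: "p \<in> mon_ideal {a. var_mon x + a \<in> M}"
    show "indet x * p \<in> mon_ideal M"
      unfolding mon_ideal_iff
    proof (intro allI impI)
      fix a assume a: "a \<notin> M"
      show "Poly_Mapping.lookup (indet x * p) a = 0"
      proof (cases "Poly_Mapping.lookup a x = 0")
        case True
        thus ?thesis by (rule lookup_indet_times_eq_0)
      next
        case False
        then obtain b where "a = var_mon x + b" by (auto elim: mon_split[of a x])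
        with p a show ?thesis by (simp add: lookup_indet_times_add mon_ideal_iff)
      qed
    qed
  next
    assume p: "indet x * p \<in> mon_ideal M"
    show "p \<in> mon_ideal {a. var_mon x + a \<in> M}"
      unfolding mon_ideal_iff
    proof (intro allI impI)
      fix a assume "a \<notin> {a. var_mon x + a \<in> M}"
      with p have "Poly_Mapping.lookup (indet x * p) (var_mon x + a) = 0"
        by (simp add: mon_ideal_iff)
      thus "Poly_Mapping.lookup p a = 0" by (simp only: lookup_indet_times_add)
    qed
  qed
  have "indet x * kos_diff y T \<in> mon_ideal M" for T
  proof -
    have "indet x * kos_diff y T = kos_diff (\<lambda>T. r T - (r T - indet x * y T)) T"
      by (simp add: kos_diff_mult)
    also have "\<dots> = kos_diff r T - kos_diff (\<lambda>T. r T - indet x * y T) T"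
      by (rule kos_diff_diff)
    also have "kos_diff r T = kos_diff w T"
      unfolding r_def by (simp add: kos_diff_diff)
    finally show ?thesis using w m M by (simp add: mon_ideal_diff mon_ideal_kos_diff)
  qed
  hence "kos_diff y T \<in> mon_ideal {a. var_mon x + a \<in> M}" for T
    by (simp add: colon_iff)
  with colon hy obtain u' where u': "\<And>T. homogeneous (c - 1 - 1) (u' T)"
    and "\<And>T. y T - kos_diff u' T \<in> mon_ideal {a. var_mon x + a \<in> M}"
    by (rule koszul_vanishingE) (rule that)
  hence y: "indet x * (y T - kos_diff u' T) \<in> mon_ideal M" for T
    by (simp add: colon_iff)
  define v where "v T = u T + indet x * u' T" for T
  have "homogeneous (c - 1) (v T)" for T
    unfolding v_def by (intro homogeneous_add homogeneous_indet_times u u')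
  moreover have "w T - kos_diff v T \<in> mon_ideal M" for T
  proof -
    have "kos_diff v T = kos_diff u T + indet x * kos_diff u' T"
      unfolding v_def by (simp add: kos_diff_add kos_diff_mult)
    hence "w T - kos_diff v T = (r T - indet x * y T) + indet x * (y T - kos_diff u' T)"
      by (simp add: r_def right_diff_distrib)
    with m y show ?thesis by (simp only: mon_ideal_add)
  qed
  ultimately show "\<exists>u. (\<forall>T. homogeneous (c - 1) (u T)) \<and> (\<forall>T. w T - kos_diff u T \<in> mon_ideal M)"
    by (intro exI[of _ v]) simp
qed

definition koszul_reg_le :: "('v::finite, 'k::field) mpoly set \<Rightarrow> nat \<Rightarrow> bool" where
  "koszul_reg_le I \<rho> \<longleftrightarrow> (\<forall>c > int \<rho>. koszul_vanishing I c)"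

lemma koszul_reg_le_mono: "koszul_reg_le I \<rho> \<Longrightarrow> \<rho> \<le> \<sigma> \<Longrightarrow> koszul_reg_le I \<sigma>"
  unfolding koszul_reg_le_def by force

section \<open>Ideals of variables and pairs of variables\<close>

text \<open>The monomials of the ideal generated by the variables outside \<open>V\<close> and the products \<open>x\<^sub>u x\<^sub>v\<close> with
  \<open>R u v\<close>. Only the set \<open>V\<close> of surviving vertices changes in the recursion, while \<open>R\<close> stays fixed:
  pairs with an end outside \<open>V\<close> contribute nothing new.\<close>

definition pair_mons :: "('v \<Rightarrow> 'v \<Rightarrow> bool) \<Rightarrow> 'v set \<Rightarrow> ('v \<Rightarrow>\<^sub>0 nat) set" where
  "pair_mons R V = off_mons V \<union>
     {a. \<exists>u v. R u v \<and> Poly_Mapping.lookup a u > 0 \<and> Poly_Mapping.lookup a v > 0}"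

lemma mult_closed_pair_mons: "mult_closed (pair_mons R V)"
  unfolding mult_closed_def pair_mons_def off_mons_def by (fastforce simp: lookup_add)

lemma pair_mons_independent:
  assumes "\<And>u v. u \<in> V \<Longrightarrow> v \<in> V \<Longrightarrow> \<not> R u v"
  shows "pair_mons R V = off_mons V"
  using assms unfolding pair_mons_def off_mons_def by blast

lemma pair_mons_colon:
  assumes "symp R" "irreflp R" "x \<in> V"
  shows "{a. var_mon x + a \<in> pair_mons R V} = pair_mons R (V - {y. R x y})"
proof -
  have pos: "Poly_Mapping.lookup (var_mon x + a) u > 0 \<longleftrightarrow> u = x \<or> Poly_Mapping.lookup a u > 0" for a u
    by (auto simp: lookup_add lookup_single when_def)
  show ?thesis
    unfolding pair_mons_def off_mons_def Un_iff mem_Collect_eq pos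
    using assms by (auto dest: sympD irreflpD)
qed

lemma pair_mons_plus:
  "pair_mons R V \<union> {a. Poly_Mapping.lookup a x > 0} = pair_mons R (V - {x})"
  unfolding pair_mons_def off_mons_def by auto

text \<open>Think of \<open>idx\<close> as the position along a path and of \<open>f n\<close> as the budget available from position
  \<open>n\<close> on. By \<open>gap\<close> a pair starting at \<open>u\<close> costs one unit of the budget, and by \<open>near\<close> the colon ideal at
  the partner \<open>x\<close> leaves no vertex with a partner within the next two positions. Both ideals of the
  recursion have fewer surviving vertices: \<open>u\<close> is lost in the colon ideal, \<open>x\<close> in the sum.\<close>

lemma koszul_reg_le_pair_mons:
  fixes V :: "'v::finite set" and f :: "nat \<Rightarrow> nat" and idx :: "'v \<Rightarrow> nat"
  assumes R: "symp R" "irreflp R" and inj: "inj_on idx U" and f: "antimono f"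
    and gap: "\<And>u x. u \<in> U \<Longrightarrow> x \<in> U \<Longrightarrow> R u x \<Longrightarrow> idx u < idx x \<Longrightarrow> f (idx u + 2) < f (idx u)"
    and near: "\<And>u x y. u \<in> U \<Longrightarrow> x \<in> U \<Longrightarrow> R u x \<Longrightarrow> idx u < idx x \<Longrightarrow> y \<in> U \<Longrightarrow>
        idx y = idx u + 1 \<Longrightarrow> y = x \<or> R x y"
    and V: "V \<subseteq> U" "\<And>v y. v \<in> V \<Longrightarrow> y \<in> V \<Longrightarrow> R v y \<Longrightarrow> n \<le> idx v"
  shows "koszul_reg_le (mon_ideal (pair_mons R V) :: ('v, 'k::field) mpoly set) (f n)"
  using V
proof (induction "card V" arbitrary: V n rule: less_induct)
  case less
  show ?case
  proof (cases "\<exists>v\<in>V. \<exists>y\<in>V. R v y")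
    case False
    hence "pair_mons R V = off_mons V" by (intro pair_mons_independent) blast
    thus ?thesis by (simp add: koszul_reg_le_def koszul_vanishing_variables)
  next
    case True
    \<comment> \<open>Vertices without partner cannot be split off by the recursion, so the minimum is taken over
        the others.\<close>
    define n0 where "n0 = (LEAST m. \<exists>v\<in>V. \<exists>y\<in>V. R v y \<and> idx v = m)"
    have "\<exists>v\<in>V. \<exists>y\<in>V. R v y \<and> idx v = n0"
      unfolding n0_def by (rule LeastI_ex) (use True in blast)
    then obtain u x where ux: "u \<in> V" "x \<in> V" "R u x" "idx u = n0" by blast
    have least: "n0 \<le> idx v" if "v \<in> V" "y \<in> V" "R v y" for v y
      unfolding n0_def by (rule Least_le) (use that in blast)
    have "R x u" using ux R(1) by (blast dest: sympD)
    have "u \<noteq> x" using ux R(2) by (auto dest: irreflpD)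
    hence "idx u \<noteq> idx x" using ux less.prems(1) inj by (auto dest: inj_onD)
    with least[OF ux(2,1) \<open>R x u\<close>] ux have ux': "idx u < idx x" by simp
    have U: "u \<in> U" "x \<in> U" using ux less.prems(1) by auto
    let ?N = "{y. R x y}"
    have colon: "koszul_reg_le (mon_ideal (pair_mons R (V - ?N)) :: ('v, 'k) mpoly set) (f (n0 + 2))"
    proof (rule less.hyps)
      show "card (V - ?N) < card V"
        using ux \<open>R x u\<close> by (intro psubset_card_mono) auto
      show "V - ?N \<subseteq> U" using less.prems(1) by blast
      fix v y assume vy: "v \<in> V - ?N" "y \<in> V - ?N" "R v y"
      \<comment> \<open>\<open>u\<close> is killed; a vertex at the next position is either killed or is \<open>x\<close> itself, all of
          whose partners are killed.\<close>
      have "v \<noteq> u" using vy \<open>R x u\<close> by blast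
      moreover have "v \<in> U" using vy less.prems(1) by blast
      ultimately have "idx v \<noteq> n0" using U ux(4) inj by (auto dest: inj_onD)
      moreover have "idx v \<noteq> n0 + 1"
        using near[OF U ux(3) ux' \<open>v \<in> U\<close>] ux(4) vy by auto
      moreover have "n0 \<le> idx v" using least[of v y] vy by blast
      ultimately show "n0 + 2 \<le> idx v" by linarith
    qed
    have plus: "koszul_reg_le (mon_ideal (pair_mons R (V - {x})) :: ('v, 'k) mpoly set) (f n0)"
    proof (rule less.hyps)
      show "card (V - {x}) < card V" using ux by (intro psubset_card_mono) auto
      show "V - {x} \<subseteq> U" using less.prems(1) by blast
      show "n0 \<le> idx v" if "v \<in> V - {x}" "y \<in> V - {x}" "R v y" for v y
        using least[of v y] that by blast
    qed
    have drop: "f (n0 + 2) < f n0" using gap[OF U ux(3) ux'] ux(4) by simp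
    have "koszul_reg_le (mon_ideal (pair_mons R V) :: ('v, 'k) mpoly set) (f n0)"
      unfolding koszul_reg_le_def
    proof (intro allI impI)
      fix c assume c: "c > int (f n0)"
      show "koszul_vanishing (mon_ideal (pair_mons R V) :: ('v, 'k) mpoly set) c"
      proof (rule koszul_vanishing_colon_sum[where x = x])
        show "mult_closed (pair_mons R V)" by (rule mult_closed_pair_mons)
        show "koszul_vanishing (mon_ideal {a. var_mon x + a \<in> pair_mons R V} :: ('v, 'k) mpoly set) (c - 1)"
          unfolding pair_mons_colon[OF R ux(2)] using colon c drop
          by (simp add: koszul_reg_le_def)
        show "koszul_vanishing (mon_ideal (pair_mons R V \<union> {a. Poly_Mapping.lookup a x > 0})
            :: ('v, 'k) mpoly set) c"
          unfolding pair_mons_plus using plus c by (simp add: koszul_reg_le_def)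
      qed
    qed
    moreover have "n \<le> n0" using less.prems(2)[OF ux(1-3)] ux(4) by simp
    hence "f n0 \<le> f n" using f by (simp add: antimonoD)
    ultimately show ?thesis by (rule koszul_reg_le_mono)
  qed
qed

section \<open>Degrees in a minimal resolution\<close>

lemma irrelevant_ideal_subset:
  "irrelevant_ideal \<subseteq> (mon_ideal (off_mons {}) :: ('v::finite, 'k::field) mpoly set)"
proof -
  interpret poly: Modules.module "(*) :: ('v, 'k) mpoly \<Rightarrow> _"
    by standard (simp_all add: algebra_simps)
  have "indet v \<in> mon_ideal (off_mons {})" for v :: 'v
    by (simp add: mon_ideal_def off_mons_def indet_def lookup_single when_def)
  moreover have "poly.subspace (mon_ideal (off_mons {}))"
    by (intro poly.subspaceI mon_ideal_0 mon_ideal_add mon_ideal_mult mult_closed_off_mons)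
  ultimately show ?thesis
    unfolding irrelevant_ideal_def ideal_gen_def by (intro poly.span_minimal) blast+
qed

lemma kos_diff_in_off_mons: "kos_diff w T \<in> mon_ideal (off_mons {})"
proof -
  have "indet v * p \<in> mon_ideal (off_mons {})" for v and p :: "('a, 'b) mpoly"
    unfolding mon_ideal_iff by (simp add: off_mons_def lookup_indet_times_eq_0)
  thus ?thesis unfolding kos_diff_def by (intro mon_ideal_sum mon_ideal_kos_sign)
qed

text \<open>Exactness of the Koszul complex of \<open>S\<close>, with a primitive of the correct degree. In positive degree
  this is the case \<open>V = UNIV\<close> of the vanishing for ideals of variables. A cycle with constant
  coefficients need not be a boundary, but coefficients in the irrelevant ideal exclude nonzero
  constants.\<close>

lemma kos_diff_exact:
  fixes w :: "'v::finite set \<Rightarrow> ('v, 'k::field) mpoly"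
  assumes hom: "\<And>T. homogeneous c (w T)" and "\<And>T. kos_diff w T = 0"
    and const: "\<And>T. w T \<in> mon_ideal (off_mons {})"
  obtains u where "\<And>T. homogeneous (c - 1) (u T)" "\<And>T. w T = kos_diff u T"
proof (cases "c \<ge> 1")
  case True
  have zero: "p \<in> mon_ideal (off_mons UNIV) \<longleftrightarrow> p = 0" for p :: "('v, 'k) mpoly"
    by (simp add: mon_ideal_def off_mons_def)
  have "kos_diff w T \<in> mon_ideal (off_mons UNIV)" for T using assms(2) by (simp add: zero)
  with koszul_vanishing_variables[OF True] hom
  obtain u where "\<And>T. homogeneous (c - 1) (u T)" "\<And>T. w T - kos_diff u T \<in> mon_ideal (off_mons UNIV)"
    by (rule koszul_vanishingE) (rule that)
  with that[of u] show thesis by (simp add: zero)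
next
  case False
  have "w T = 0" for T
  proof -
    have "Poly_Mapping.keys (w T) = {}"
    proof (rule equals0I)
      fix a assume a: "a \<in> Poly_Mapping.keys (w T)"
      hence "int (total_degree a) = c" using hom[of T] by (simp add: homogeneous_def)
      hence "a = 0" using False by (simp add: total_degree_eq_0_iff[symmetric])
      moreover have "a \<in> off_mons {}" using const[of T] a unfolding mon_ideal_def by blast
      ultimately show False by (simp add: off_mons_def)
    qed
    thus ?thesis by simp
  qed
  with that[of "\<lambda>T. 0"] show thesis by simp
qed

definition kos_diff_vec ::
    "nat \<Rightarrow> ('v::finite set \<Rightarrow> ('v, 'k::field) mpoly vec) \<Rightarrow> 'v set \<Rightarrow> ('v, 'k) mpoly vec" where
  "kos_diff_vec r w T = vec r (\<lambda>k. kos_diff (\<lambda>T. w T $ k) T)"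

lemma kos_diff_vec_carrier [simp]: "kos_diff_vec r w T \<in> carrier_vec r"
  by (simp add: kos_diff_vec_def)

lemma dim_kos_diff_vec [simp]: "dim_vec (kos_diff_vec r w T) = r"
  by (simp add: kos_diff_vec_def)

lemma kos_diff_scalar_prod:
  assumes "dim_vec e = r" "\<And>T. w T \<in> carrier_vec r"
  shows "e \<bullet> kos_diff_vec r w T = kos_diff (\<lambda>T. e \<bullet> w T) T"
proof -
  have "dim_vec (w T) = r" for T using assms(2)[of T] by simp
  thus ?thesis by (simp add: scalar_prod_def kos_diff_vec_def kos_diff_sum kos_diff_mult)
qed

lemma kos_diff_mult_mat_vec:
  assumes A: "A \<in> carrier_mat n m" and w: "\<And>T. w T \<in> carrier_vec m"
  shows "A *\<^sub>v kos_diff_vec m w T = kos_diff_vec n (\<lambda>T. A *\<^sub>v w T) T"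
proof (rule eq_vecI)
  fix l assume "l < dim_vec (kos_diff_vec n (\<lambda>T. A *\<^sub>v w T) T)"
  hence l: "l < n" "l < dim_row A" using A by auto
  hence "(A *\<^sub>v kos_diff_vec m w T) $ l = kos_diff (\<lambda>T. row A l \<bullet> w T) T"
    using A w by (simp add: kos_diff_scalar_prod)
  thus "(A *\<^sub>v kos_diff_vec m w T) $ l = kos_diff_vec n (\<lambda>T. A *\<^sub>v w T) T $ l"
    using l by (simp add: kos_diff_vec_def)
qed (use A in simp)

lemma kos_diff_vec_kos_diff_vec: "kos_diff_vec r (kos_diff_vec r w) T = 0\<^sub>v r"
proof (rule eq_vecI)
  fix k assume "k < dim_vec (0\<^sub>v r :: ('a, 'b) mpoly vec)"
  moreover from this have "(\<lambda>T. kos_diff_vec r w T $ k) = kos_diff (\<lambda>T. w T $ k)"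
    by (simp add: kos_diff_vec_def)
  ultimately show "kos_diff_vec r (kos_diff_vec r w) T $ k = (0\<^sub>v r :: ('a, 'b) mpoly vec) $ k"
    by (simp add: kos_diff_vec_def[of r "kos_diff_vec r w"])
qed simp

lemma kos_diff_vec_diff:
  assumes "\<And>T. w T \<in> carrier_vec r" "\<And>T. w' T \<in> carrier_vec r"
  shows "kos_diff_vec r (\<lambda>T. w T - w' T) T = kos_diff_vec r w T - kos_diff_vec r w' T"
proof (rule eq_vecI)
  fix k assume "k < dim_vec (kos_diff_vec r w T - kos_diff_vec r w' T)"
  hence k: "k < r" by simp
  have "dim_vec (w' T) = r" for T using assms(2)[of T] by simp
  with k show "kos_diff_vec r (\<lambda>T. w T - w' T) T $ k = (kos_diff_vec r w T - kos_diff_vec r w' T) $ k"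
    by (simp add: kos_diff_vec_def kos_diff_diff)
qed simp

text \<open>Vanishing of the Koszul homology of the quotient of a graded free module by \<open>N\<close>, in coefficient
  degree \<open>a\<close>; the \<open>k\<close>-th unit vector has degree \<open>d k\<close>. The primitive \<open>u\<close> carries no degree condition,
  which spares a decomposition into homogeneous components below.\<close>

definition koszul_vanishing_vec ::
    "nat \<Rightarrow> (nat \<Rightarrow> int) \<Rightarrow> ('v::finite, 'k::field) mpoly vec set \<Rightarrow> int \<Rightarrow> bool" where
  "koszul_vanishing_vec r d N a \<longleftrightarrow>
     (\<forall>w. (\<forall>T. w T \<in> carrier_vec r) \<and> (\<forall>T. \<forall>k<r. homogeneous (a - d k) (w T $ k)) \<and>
        (\<forall>T. kos_diff_vec r w T \<in> N) \<longrightarrow>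
        (\<exists>u. (\<forall>T. u T \<in> carrier_vec r) \<and> (\<forall>T. w T - kos_diff_vec r u T \<in> N)))"

lemma koszul_vanishing_vecE:
  assumes "koszul_vanishing_vec r d N a" "\<And>T. w T \<in> carrier_vec r"
    "\<And>T k. k < r \<Longrightarrow> homogeneous (a - d k) (w T $ k)" "\<And>T. kos_diff_vec r w T \<in> N"
  obtains u where "\<And>T. u T \<in> carrier_vec r" "\<And>T. w T - kos_diff_vec r u T \<in> N"
  using assms unfolding koszul_vanishing_vec_def by metis

text \<open>Dimension shifting: vanishing for the cokernel of \<open>D\<close> gives vanishing, one coefficient degree
  higher, for the image of \<open>D\<close>, which by exactness is the cokernel of \<open>D'\<close>. A cycle \<open>w\<close> is mapped by
  \<open>D\<close> to a genuine cycle \<open>b\<close> of the free module, which is a boundary of some \<open>vv\<close>; then \<open>vv\<close> is a cycle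
  modulo the image of \<open>D\<close>, hence a boundary modulo that image, and the correction term is a primitive
  of \<open>w\<close>. Minimality puts the coefficients of \<open>b\<close> into the irrelevant ideal, which is why the step
  also works in homological degree zero, where the Koszul complex of \<open>S\<close> is not exact.\<close>

lemma koszul_vanishing_vec_syzygy:
  fixes D D' :: "('v::finite, 'k::field) mpoly mat"
  assumes D: "D \<in> carrier_mat r s"
    and hom: "\<And>l k. l < r \<Longrightarrow> k < s \<Longrightarrow> homogeneous (d' k - d l) (D $$ (l, k))"
    and minimal: "\<And>l k. l < r \<Longrightarrow> k < s \<Longrightarrow> D $$ (l, k) \<in> irrelevant_ideal"
    and exact: "{x \<in> carrier_vec s. D *\<^sub>v x = 0\<^sub>v r} = (\<lambda>y. D' *\<^sub>v y) ` carrier_vec t"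
    and van: "koszul_vanishing_vec r d ((\<lambda>y. D *\<^sub>v y) ` carrier_vec s) (a - 1)"
  shows "koszul_vanishing_vec s d' ((\<lambda>y. D' *\<^sub>v y) ` carrier_vec t) a"
  unfolding koszul_vanishing_vec_def exact[symmetric]
proof (intro allI impI, elim conjE)
  fix w :: "'v set \<Rightarrow> ('v, 'k) mpoly vec"
  assume "\<forall>T. w T \<in> carrier_vec s"
    and whom: "\<forall>T. \<forall>k<s. homogeneous (a - d' k) (w T $ k)"
    and cyc: "\<forall>T. kos_diff_vec s w T \<in> {x \<in> carrier_vec s. D *\<^sub>v x = 0\<^sub>v r}"
  hence w: "w T \<in> carrier_vec s" and dim: "dim_vec (w T) = s" for T
    by (auto dest: spec[of _ T])
  define b where "b T = D *\<^sub>v w T" for T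
  have b: "b T \<in> carrier_vec r" for T using D w by (simp add: b_def)
  have b_nth: "b T $ l = (\<Sum>k<s. D $$ (l, k) * w T $ k)" if "l < r" for T l
    using D that by (simp add: b_def scalar_prod_def dim lessThan_atLeast0)
  have bD: "kos_diff_vec r b T = 0\<^sub>v r" for T
    using kos_diff_mult_mat_vec[OF D, of w T] w cyc by (simp add: b_def[abs_def])
  have "\<exists>v. (\<forall>T. homogeneous (a - d l - 1) (v T)) \<and> (\<forall>T. b T $ l = kos_diff v T)" if l: "l < r" for l
  proof -
    have "homogeneous (a - d l) (b T $ l)" for T
      unfolding b_nth[OF l]
    proof (rule homogeneous_sum)
      fix k assume "k \<in> {..<s}"
      hence "homogeneous ((d' k - d l) + (a - d' k)) (D $$ (l, k) * w T $ k)"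
        using whom by (intro homogeneous_mult hom l) auto
      thus "homogeneous (a - d l) (D $$ (l, k) * w T $ k)" by simp
    qed
    moreover have "kos_diff (\<lambda>T. b T $ l) T = 0" for T
    proof -
      have "kos_diff_vec r b T $ l = 0\<^sub>v r $ l" by (simp only: bD)
      with l show ?thesis by (simp add: kos_diff_vec_def)
    qed
    moreover have "b T $ l \<in> mon_ideal (off_mons {})" for T
      unfolding b_nth[OF l]
    proof (rule mon_ideal_sum)
      fix k assume "k \<in> {..<s}"
      hence "D $$ (l, k) \<in> mon_ideal (off_mons {})"
        using minimal[OF l, of k] irrelevant_ideal_subset by auto
      thus "D $$ (l, k) * w T $ k \<in> mon_ideal (off_mons {})"
        by (subst mult.commute) (rule mon_ideal_mult[OF mult_closed_off_mons])
    qed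
    ultimately obtain v where "\<And>T. homogeneous (a - d l - 1) (v T)" "\<And>T. b T $ l = kos_diff v T"
      by (rule kos_diff_exact) (rule that)
    thus ?thesis by (intro exI[of _ v]) simp
  qed
  then obtain v where v: "\<And>l T. l < r \<Longrightarrow> homogeneous (a - d l - 1) (v l T)"
    "\<And>l T. l < r \<Longrightarrow> b T $ l = kos_diff (v l) T"
    by metis
  define vv where "vv T = vec r (\<lambda>l. v l T)" for T
  have vv: "vv T \<in> carrier_vec r" for T by (simp add: vv_def)
  have vvD: "kos_diff_vec r vv T = b T" for T
    by (rule eq_vecI) (use b[of T] in \<open>simp_all add: kos_diff_vec_def vv_def v(2)\<close>)
  obtain u' where u': "\<And>T. u' T \<in> carrier_vec r"
    and "\<And>T. vv T - kos_diff_vec r u' T \<in> (\<lambda>y. D *\<^sub>v y) ` carrier_vec s"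
  proof (rule koszul_vanishing_vecE[OF van])
    show "vv T \<in> carrier_vec r" for T by (rule vv)
    show "homogeneous (a - 1 - d k) (vv T $ k)" if "k < r" for T k
      using v(1)[OF that, of T] that by (simp add: vv_def algebra_simps)
    show "kos_diff_vec r vv T \<in> (\<lambda>y. D *\<^sub>v y) ` carrier_vec s" for T
      using w by (simp add: vvD b_def)
  qed (rule that)
  hence "\<forall>T. \<exists>y. y \<in> carrier_vec s \<and> vv T - kos_diff_vec r u' T = D *\<^sub>v y" by blast
  then obtain y where y: "\<And>T. y T \<in> carrier_vec s" "\<And>T. vv T - kos_diff_vec r u' T = D *\<^sub>v y T"
    by metis
  have "D *\<^sub>v (w T - kos_diff_vec s y T) = 0\<^sub>v r" for T
  proof -
    have "D *\<^sub>v kos_diff_vec s y T = kos_diff_vec r (\<lambda>T. vv T - kos_diff_vec r u' T) T"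
      using kos_diff_mult_mat_vec[OF D y(1)] by (simp add: y(2))
    also have "\<dots> = kos_diff_vec r vv T - kos_diff_vec r (kos_diff_vec r u') T"
      using vv by (intro kos_diff_vec_diff) simp_all
    also have "\<dots> = b T"
      using b[of T] by (simp add: vvD kos_diff_vec_kos_diff_vec)
    finally have "D *\<^sub>v kos_diff_vec s y T = b T" .
    moreover have "D *\<^sub>v (w T - kos_diff_vec s y T) = D *\<^sub>v w T - D *\<^sub>v kos_diff_vec s y T"
      using w by (intro mult_minus_distrib_mat_vec[OF D]) simp_all
    ultimately show ?thesis using b[of T] by (simp add: b_def)
  qed
  thus "\<exists>u. (\<forall>T. u T \<in> carrier_vec s) \<and>
      (\<forall>T. w T - kos_diff_vec s u T \<in> {x \<in> carrier_vec s. D *\<^sub>v x = 0\<^sub>v r})"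
    using w y(1) by (intro exI[of _ y]) simp
qed

text \<open>The start of the dimension shifting: \<open>e\<close> identifies the cokernel of the first differential with
  \<open>S/I\<close>.\<close>

lemma koszul_vanishing_vec_quotient:
  fixes e :: "('v::finite, 'k::field) mpoly vec"
  assumes e: "e \<in> carrier_vec r" and hom: "\<And>k. k < r \<Longrightarrow> homogeneous (d k) (e $ k)"
    and M: "mult_closed M" and surj: "\<And>p. \<exists>x\<in>carrier_vec r. p - e \<bullet> x \<in> mon_ideal M"
    and van: "koszul_vanishing (mon_ideal M :: ('v, 'k) mpoly set) a"
  shows "koszul_vanishing_vec r d {x \<in> carrier_vec r. e \<bullet> x \<in> mon_ideal M} a"
  unfolding koszul_vanishing_vec_def
proof (intro allI impI, elim conjE)
  fix w :: "'v set \<Rightarrow> ('v, 'k) mpoly vec"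
  assume "\<forall>T. w T \<in> carrier_vec r"
    and whom: "\<forall>T. \<forall>k<r. homogeneous (a - d k) (w T $ k)"
    and cyc: "\<forall>T. kos_diff_vec r w T \<in> {x \<in> carrier_vec r. e \<bullet> x \<in> mon_ideal M}"
  hence w: "w T \<in> carrier_vec r" and dim: "dim_vec (w T) = r" for T
    by (auto dest: spec[of _ T])
  have de: "dim_vec e = r" using e by simp
  have "homogeneous a (e \<bullet> w T)" for T
    unfolding scalar_prod_def
  proof (rule homogeneous_sum)
    fix k assume "k \<in> {0..<dim_vec (w T)}"
    hence "homogeneous (d k + (a - d k)) (e $ k * w T $ k)"
      using whom by (intro homogeneous_mult hom) (auto simp: dim)
    thus "homogeneous a (e $ k * w T $ k)" by simp
  qed
  moreover have "kos_diff (\<lambda>T. e \<bullet> w T) T \<in> mon_ideal M" for T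
    using cyc by (simp flip: kos_diff_scalar_prod[OF de w])
  ultimately obtain u where u: "\<And>T. e \<bullet> w T - kos_diff u T \<in> mon_ideal M"
    using van by (elim koszul_vanishingE[of _ _ "\<lambda>T. e \<bullet> w T"]) auto
  have "\<forall>T. \<exists>x. x \<in> carrier_vec r \<and> u T - e \<bullet> x \<in> mon_ideal M" using surj by blast
  then obtain y where y: "\<And>T. y T \<in> carrier_vec r" "\<And>T. u T - e \<bullet> y T \<in> mon_ideal M"
    by metis
  have "e \<bullet> (w T - kos_diff_vec r y T) \<in> mon_ideal M" for T
  proof -
    have "e \<bullet> (w T - kos_diff_vec r y T) = e \<bullet> w T - kos_diff (\<lambda>T. e \<bullet> y T) T"
      using e w y(1) by (simp add: scalar_prod_minus_distrib kos_diff_scalar_prod[OF de y(1)])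
    also have "\<dots> = (e \<bullet> w T - kos_diff u T) + kos_diff (\<lambda>T. u T - e \<bullet> y T) T"
      by (simp add: kos_diff_diff)
    finally show ?thesis
      using u y(2) by (simp add: mon_ideal_add mon_ideal_kos_diff[OF M])
  qed
  thus "\<exists>u. (\<forall>T. u T \<in> carrier_vec r) \<and>
      (\<forall>T. w T - kos_diff_vec r u T \<in> {x \<in> carrier_vec r. e \<bullet> x \<in> mon_ideal M})"
    using w y(1) by (intro exI[of _ y]) simp
qed

text \<open>The unit vector \<open>k\<close>, placed at \<open>T = {}\<close>, is a cycle. If it were a boundary modulo the image of \<open>D\<close>,
  then its \<open>k\<close>-th entry \<open>1\<close> would lie in the irrelevant ideal.\<close>

lemma koszul_vanishing_vec_no_generator:
  fixes D :: "('v::finite, 'k::field) mpoly mat"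
  assumes D: "D \<in> carrier_mat r s"
    and minimal: "\<And>l k. l < r \<Longrightarrow> k < s \<Longrightarrow> D $$ (l, k) \<in> irrelevant_ideal"
    and van: "koszul_vanishing_vec r d ((\<lambda>y. D *\<^sub>v y) ` carrier_vec s) a"
    and k: "k < r"
  shows "d k \<noteq> a"
proof
  assume a: "d k = a"
  define w :: "'v set \<Rightarrow> ('v, 'k) mpoly vec" where
    "w T = (if T = {} then unit_vec r k else 0\<^sub>v r)" for T
  have w: "w T \<in> carrier_vec r" for T by (simp add: w_def)
  obtain u where u: "\<And>T. u T \<in> carrier_vec r"
    and "\<And>T. w T - kos_diff_vec r u T \<in> (\<lambda>y. D *\<^sub>v y) ` carrier_vec s"
  proof (rule koszul_vanishing_vecE[OF van])
    show "w T \<in> carrier_vec r" for T by (rule w)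
    show "homogeneous (a - d l) (w T $ l)" if "l < r" for T l
      using that k a by (simp add: w_def homogeneous_def total_degree_eq_0_iff)
    have "kos_diff_vec r w T = D *\<^sub>v 0\<^sub>v s" for T
      using D by (intro eq_vecI) (simp_all add: kos_diff_vec_def w_def kos_diff_def)
    thus "kos_diff_vec r w T \<in> (\<lambda>y. D *\<^sub>v y) ` carrier_vec s" for T
      by (intro image_eqI[of _ _ "0\<^sub>v s"]) simp_all
  qed (rule that)
  then obtain y where y: "y \<in> carrier_vec s" "w {} - kos_diff_vec r u {} = D *\<^sub>v y" by blast
  have "(D *\<^sub>v y) $ k \<in> mon_ideal (off_mons {})"
  proof -
    have "(D *\<^sub>v y) $ k = (\<Sum>l<s. D $$ (k, l) * y $ l)"
      using D k y(1) by (simp add: scalar_prod_def lessThan_atLeast0)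
    also have "\<dots> \<in> mon_ideal (off_mons {})"
    proof (rule mon_ideal_sum)
      fix l assume "l \<in> {..<s}"
      hence "D $$ (k, l) \<in> mon_ideal (off_mons {})"
        using minimal[OF k, of l] irrelevant_ideal_subset by auto
      thus "D $$ (k, l) * y $ l \<in> mon_ideal (off_mons {})"
        by (subst mult.commute) (rule mon_ideal_mult[OF mult_closed_off_mons])
    qed
    finally show ?thesis .
  qed
  moreover have "(D *\<^sub>v y) $ k = 1 - kos_diff (\<lambda>T. u T $ k) {}"
    unfolding y(2)[symmetric] using k by (simp add: w_def kos_diff_vec_def)
  ultimately have "1 - kos_diff (\<lambda>T. u T $ k) {} + kos_diff (\<lambda>T. u T $ k) {} \<in> mon_ideal (off_mons {})"
    by (intro mon_ideal_add kos_diff_in_off_mons) simp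
  hence "(1 :: ('v, 'k) mpoly) \<in> mon_ideal (off_mons {})" by simp
  thus False by (simp add: mon_ideal_def off_mons_def)
qed

lemma reg_quotient_le_koszul:
  fixes M :: "('v::finite \<Rightarrow>\<^sub>0 nat) set"
  assumes M: "mult_closed M" and reg: "koszul_reg_le (mon_ideal M :: ('v, 'k::field) mpoly set) \<rho>"
  shows "reg_quotient (mon_ideal M :: ('v, 'k) mpoly set) \<le> ereal (real \<rho>)"
  unfolding reg_quotient_def
proof (rule SUP_least, clarsimp)
  fix i j assume "(i, j) \<in> betti_support (mon_ideal M :: ('v, 'k) mpoly set)"
  then obtain r d e D k where
    res: "minimal_graded_free_resolution (mon_ideal M :: ('v, 'k) mpoly set) r d e D"
    and k: "k < r i" "d i k = j"
    unfolding betti_support_def by blast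
  let ?N = "\<lambda>i. (\<lambda>y. D i *\<^sub>v y) ` carrier_vec (r (Suc i))"
  have e: "e \<in> carrier_vec (r 0)" and D: "\<And>i. D i \<in> carrier_mat (r i) (r (Suc i))"
    and ehom: "\<And>k. k < r 0 \<Longrightarrow> homogeneous (d 0 k) (e $ k)"
    and Dhom: "\<And>i l k. l < r i \<Longrightarrow> k < r (Suc i) \<Longrightarrow> homogeneous (d (Suc i) k - d i l) (D i $$ (l, k))"
    and surj: "\<And>p. \<exists>x\<in>carrier_vec (r 0). p - e \<bullet> x \<in> mon_ideal M"
    and exact0: "{x \<in> carrier_vec (r 0). e \<bullet> x \<in> mon_ideal M} = (\<lambda>y. D 0 *\<^sub>v y) ` carrier_vec (r 1)"
    and exact: "\<And>i. {x \<in> carrier_vec (r (Suc i)). D i *\<^sub>v x = 0\<^sub>v (r i)} = ?N (Suc i)"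
    and minimal: "\<And>i l k. l < r i \<Longrightarrow> k < r (Suc i) \<Longrightarrow> D i $$ (l, k) \<in> irrelevant_ideal"
    using res unfolding minimal_graded_free_resolution_def by simp_all
  have van: "koszul_vanishing_vec (r i) (d i) (?N i) a" if "a - int i > int \<rho>" for i a
    using that
  proof (induction i arbitrary: a)
    case 0
    hence "koszul_vanishing (mon_ideal M :: ('v, 'k) mpoly set) a"
      using reg by (simp add: koszul_reg_le_def)
    from koszul_vanishing_vec_quotient[OF e ehom M surj this] show ?case
      unfolding exact0 by simp
  next
    case (Suc i)
    hence "koszul_vanishing_vec (r i) (d i) (?N i) (a - 1)" by simp
    from koszul_vanishing_vec_syzygy[OF D Dhom minimal exact this] show ?case .
  qed
  show "real_of_int j - real i \<le> real \<rho>"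
  proof (rule ccontr)
    assume "\<not> real_of_int j - real i \<le> real \<rho>"
    hence "j - int i > int \<rho>" by linarith
    from koszul_vanishing_vec_no_generator[OF D minimal van[OF this] k(1)] k(2)
    show False by simp
  qed
qed

section \<open>Neighborhood ideals as monomial ideals\<close>

lemma prod_indet:
  "(\<Prod>j\<in>W. indet j :: ('v::finite, 'k::field) mpoly) = Poly_Mapping.single (\<Sum>j\<in>W. var_mon j) 1"
  by (induction W rule: infinite_finite_induct) (simp_all add: indet_def mult_single)

lemma lookup_sum_var_mon:
  "Poly_Mapping.lookup (\<Sum>j\<in>W. var_mon j) v = (if v \<in> (W :: 'v::finite set) then 1 else 0)"
  by (simp add: lookup_sum lookup_single when_def)

definition nbhd_mons :: "('v \<Rightarrow> nat) \<Rightarrow> 'v::finite set set \<Rightarrow> ('v \<Rightarrow>\<^sub>0 nat) set" where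
  "nbhd_mons k E =
     {a. \<exists>i W. W \<subseteq> closed_nbhd E i \<and> card W = k i \<and> (\<forall>j\<in>W. Poly_Mapping.lookup a j > 0)}"

lemma mult_closed_nbhd_mons: "mult_closed (nbhd_mons k E)"
  unfolding mult_closed_def nbhd_mons_def by (fastforce simp: lookup_add)

lemma neighborhood_ideal_eq:
  "neighborhood_ideal k E = (mon_ideal (nbhd_mons k E) :: ('v::finite, 'k::field) mpoly set)"
proof -
  interpret poly: Modules.module "(*) :: ('v, 'k) mpoly \<Rightarrow> _"
    by standard (simp_all add: algebra_simps)
  define G :: "'v \<Rightarrow> ('v, 'k) mpoly set" where
    "G i = {\<Prod>j\<in>W. indet j | W. W \<subseteq> closed_nbhd E i \<and> card W = k i}" for i
  have sum: "neighborhood_ideal k E = {sum s UNIV | s. \<forall>i\<in>UNIV. s i \<in> poly.span (G i)}"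
    unfolding neighborhood_ideal_def ideal_gen_def G_def by (rule set_sum_alt) simp
  have sub: "poly.subspace (mon_ideal (nbhd_mons k E))"
    by (intro poly.subspaceI mon_ideal_0 mon_ideal_add mon_ideal_mult mult_closed_nbhd_mons)
  have "G i \<subseteq> mon_ideal (nbhd_mons k E)" for i
  proof
    fix p assume "p \<in> G i"
    then obtain W where W: "W \<subseteq> closed_nbhd E i" "card W = k i"
      "p = Poly_Mapping.single (\<Sum>j\<in>W. var_mon j) 1"
      unfolding G_def by (auto simp: prod_indet)
    have "(\<Sum>j\<in>W. var_mon j) \<in> nbhd_mons k E"
      unfolding nbhd_mons_def using W by (auto simp: lookup_sum_var_mon)
    thus "p \<in> mon_ideal (nbhd_mons k E)" by (simp add: W mon_ideal_def)
  qed
  hence "poly.span (G i) \<subseteq> mon_ideal (nbhd_mons k E)" for i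
    by (intro poly.span_minimal sub)
  hence "neighborhood_ideal k E \<subseteq> (mon_ideal (nbhd_mons k E) :: ('v, 'k) mpoly set)"
    unfolding sum by (auto intro!: mon_ideal_sum)
  moreover have "p \<in> neighborhood_ideal k E" if p: "p \<in> mon_ideal (nbhd_mons k E)"
    for p :: "('v, 'k) mpoly"
  proof -
    have "\<exists>i. Poly_Mapping.single a c \<in> poly.span (G i)" if "a \<in> Poly_Mapping.keys p" for a c
    proof -
      from that p have "a \<in> nbhd_mons k E" unfolding mon_ideal_def by blast
      then obtain i W where W: "W \<subseteq> closed_nbhd E i" "card W = k i"
        and pos: "\<forall>j\<in>W. Poly_Mapping.lookup a j > 0"
        unfolding nbhd_mons_def by blast
      have "a = (a - (\<Sum>j\<in>W. var_mon j)) + (\<Sum>j\<in>W. var_mon j)"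
        by (rule poly_mapping_eqI) (use pos in \<open>auto simp: lookup_add lookup_minus lookup_sum_var_mon\<close>)
      hence "Poly_Mapping.single a c = Poly_Mapping.single (a - (\<Sum>j\<in>W. var_mon j)) c
          * (\<Prod>j\<in>W. indet j :: ('v, 'k) mpoly)"
        by (simp add: prod_indet mult_single)
      moreover have "(\<Prod>j\<in>W. indet j) \<in> G i" unfolding G_def using W by blast
      ultimately have "Poly_Mapping.single a c \<in> poly.span (G i)"
        by (simp add: poly.span_scale poly.span_base)
      thus ?thesis ..
    qed
    hence "\<forall>a\<in>Poly_Mapping.keys p. \<exists>i. Poly_Mapping.single a (Poly_Mapping.lookup p a) \<in> poly.span (G i)"
      by blast
    from bchoice[OF this] obtain g where g: "\<forall>a\<in>Poly_Mapping.keys p.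
        Poly_Mapping.single a (Poly_Mapping.lookup p a) \<in> poly.span (G (g a))" ..
    define s where "s i = (\<Sum>a\<in>{a \<in> Poly_Mapping.keys p. g a = i}.
        Poly_Mapping.single a (Poly_Mapping.lookup p a))" for i
    have "s i \<in> poly.span (G i)" for i
      unfolding s_def by (rule poly.span_sum) (use g in auto)
    moreover have "p = sum s UNIV"
    proof -
      have "sum s UNIV = (\<Sum>a\<in>Poly_Mapping.keys p. Poly_Mapping.single a (Poly_Mapping.lookup p a))"
        unfolding s_def by (rule sum.group) simp_all
      also have "\<dots> = p"
        by (rule poly_mapping_eqI) (simp add: lookup_sum lookup_single when_def in_keys_iff)
      finally show ?thesis ..
    qed
    ultimately show ?thesis unfolding sum by blast
  qed
  ultimately show ?thesis by blast
qed

section \<open>Caterpillars\<close>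

lemma edge_ends_distinct: "simple_graph E \<Longrightarrow> {u, v} \<in> E \<Longrightarrow> u \<noteq> v"
  by (auto simp: simple_graph_def)

lemma graph_path_segment:
  assumes p: "graph_path E p" and ij: "i \<le> j" "j < length p"
  obtains c where "graph_path E c" "hd c = p ! i" "last c = p ! j" "length c = Suc (j - i)"
    "set c \<subseteq> set p"
proof -
  define c where "c = take (Suc (j - i)) (drop i p)"
  have len: "length c = Suc (j - i)" using ij by (simp add: c_def)
  have nth: "c ! k = p ! (i + k)" if "k \<le> j - i" for k using that ij by (simp add: c_def)
  have "c \<noteq> []" using len by auto
  have "graph_path E c"
    unfolding graph_path_def successively_conv_nth
  proof (intro conjI allI impI)
    show "distinct c" using p by (simp add: c_def graph_path_def)
    fix k assume "Suc k < length c"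
    hence "c ! k = p ! (i + k)" "c ! Suc k = p ! Suc (i + k)" "Suc (i + k) < length p"
      using ij nth[of k] nth[of "Suc k"] by (simp_all add: len)
    with p show "{c ! k, c ! Suc k} \<in> E"
      by (simp add: graph_path_def successively_conv_nth)
  qed fact
  moreover have "hd c = p ! i" using nth[of 0] \<open>c \<noteq> []\<close> by (simp add: hd_conv_nth)
  moreover have "last c = p ! j"
    using nth[of "j - i"] \<open>c \<noteq> []\<close> ij by (simp add: last_conv_nth len)
  moreover have "set c \<subseteq> set p" unfolding c_def by (meson order_trans set_drop_subset set_take_subset)
  ultimately show thesis using that len by blast
qed

lemma no_chord:
  assumes acyc: "\<nexists>c. graph_cycle E c" and p: "graph_path E p"
    and ij: "i < j" "j < length p" and e: "{p ! i, p ! j} \<in> E"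
  shows "j = Suc i"
proof (rule ccontr)
  assume "j \<noteq> Suc i"
  with ij have j: "i + 2 \<le> j" by simp
  obtain c where "graph_path E c" "hd c = p ! i" "last c = p ! j" "length c = Suc (j - i)"
    using graph_path_segment[OF p, of i j] ij by auto
  with e j have "graph_cycle E c" by (simp add: graph_cycle_def insert_commute)
  with acyc show False by blast
qed

text \<open>A vertex outside the path with two neighbors on it closes a cycle through the segment between
  them, and so do two adjacent vertices outside that each have a neighbor on the path.\<close>

lemma no_triangle_over_path:
  assumes acyc: "\<nexists>c. graph_cycle E c" and p: "graph_path E p" and w: "w \<notin> set p"
    and ij: "i < j" "j < length p" and e: "{w, p ! i} \<in> E" "{w, p ! j} \<in> E"
  shows False
proof -
  obtain c where c: "graph_path E c" "hd c = p ! i" "last c = p ! j" "length c = Suc (j - i)"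
    "set c \<subseteq> set p"
    using graph_path_segment[OF p, of i j] ij by auto
  have "graph_cycle E (w # c)"
    using c w e ij by (auto simp: graph_cycle_def graph_path_def successively_Cons insert_commute)
  with acyc show False by blast
qed

lemma no_bridge_over_path:
  assumes acyc: "\<nexists>c. graph_cycle E c" and p: "graph_path E p" and w: "w \<notin> set p" "y \<notin> set p"
    and wy: "w \<noteq> y" "{w, y} \<in> E"
    and ij: "i \<le> j" "j < length p" and e: "{w, p ! i} \<in> E" "{y, p ! j} \<in> E"
  shows False
proof -
  obtain c where c: "graph_path E c" "hd c = p ! i" "last c = p ! j" "length c = Suc (j - i)"
    "set c \<subseteq> set p"
    using graph_path_segment[OF p, of i j] ij by auto
  have "graph_cycle E (y # w # c)"
    using c w wy e ij by (auto simp: graph_cycle_def graph_path_def successively_Cons insert_commute)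
  with acyc show False by blast
qed

text \<open>Every vertex off the spine is a leaf, because a second neighbor, on the spine or off it, would
  close a cycle.\<close>

lemma off_spine_degree:
  assumes E: "simple_graph E" and acyc: "\<nexists>c. graph_cycle E c" and p: "graph_path E p"
    and dom: "\<forall>v. v \<in> set p \<or> (\<exists>u\<in>set p. {u, v} \<in> E)" and w: "w \<notin> set p"
  shows "vertex_degree E w = 1"
proof -
  from dom w obtain i where i: "i < length p" "{w, p ! i} \<in> E"
    by (metis in_set_conv_nth insert_commute)
  have "y = p ! i" if y: "{w, y} \<in> E" for y
  proof (rule ccontr)
    assume ne: "y \<noteq> p ! i"
    show False
    proof (cases "y \<in> set p")
      case True
      then obtain j where j: "j < length p" "y = p ! j" by (auto simp: in_set_conv_nth)
      with ne have "i \<noteq> j" by blast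
      hence "i < j \<or> j < i" by linarith
      with no_triangle_over_path[OF acyc p w] i j y show False by blast
    next
      case False
      with dom obtain j where j: "j < length p" "{y, p ! j} \<in> E"
        by (metis in_set_conv_nth insert_commute)
      have ne: "w \<noteq> y" "y \<noteq> w" using edge_ends_distinct[OF E y] by auto
      have "{y, w} \<in> E" using y by (simp add: insert_commute)
      show False
      proof (cases "i \<le> j")
        case True
        show ?thesis by (rule no_bridge_over_path[OF acyc p w False ne(1) y True j(1) i(2) j(2)])
      next
        case *: False
        show ?thesis
          by (rule no_bridge_over_path[OF acyc p False w ne(2) \<open>{y, w} \<in> E\<close> _ i(1) j(2) i(2)])
            (use * in simp)
      qed
    qed
  qed
  hence "nbhd E w \<subseteq> {p ! i}" unfolding nbhd_def by blast
  hence "nbhd E w = {p ! i}" using i(2) unfolding nbhd_def by blast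
  thus ?thesis by (simp add: vertex_degree_def)
qed

definition inner :: "'v::finite set set \<Rightarrow> 'v set" where
  "inner E = {u. vertex_degree E u \<noteq> 1 \<and> (\<forall>y\<in>nbhd E u. vertex_degree E y \<noteq> 1)}"

lemma nbhd_sym: "y \<in> nbhd E x \<longleftrightarrow> x \<in> nbhd E y"
  by (simp add: nbhd_def insert_commute)

text \<open>An inner vertex is no leaf, so it is on the spine. Its neighbors are no leaves either, so they are
  on the spine too, and for want of chords they are next to it. As it is no leaf, both exist.\<close>

lemma inner_on_spine:
  assumes E: "simple_graph E" "no_isolated_vertices E" and acyc: "\<nexists>c. graph_cycle E c"
    and p: "graph_path E p"
    and dom: "\<forall>v. v \<in> set p \<or> (\<exists>u\<in>set p. {u, v} \<in> E)" and u: "u \<in> inner E"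
  obtains n where "0 < n" "Suc n < length p" "u = p ! n" "nbhd E u = {p ! (n - 1), p ! Suc n}"
    "vertex_degree E u = 2"
proof -
  note leaf = off_spine_degree[OF E(1) acyc p dom]
  have "u \<in> set p" using leaf[of u] u by (auto simp: inner_def)
  then obtain n where n: "n < length p" "u = p ! n" by (auto simp: in_set_conv_nth)
  let ?B = "{y. 0 < n \<and> y = p ! (n - 1) \<or> Suc n < length p \<and> y = p ! Suc n}"
  have sub: "nbhd E u \<subseteq> ?B"
  proof
    fix y assume y: "y \<in> nbhd E u"
    hence "y \<in> set p" using leaf[of y] u by (auto simp: inner_def)
    then obtain j where j: "j < length p" "y = p ! j" by (auto simp: in_set_conv_nth)
    have e: "{p ! n, p ! j} \<in> E" "{p ! j, p ! n} \<in> E"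
      using y n j by (simp_all add: nbhd_def insert_commute)
    have "j \<noteq> n" using edge_ends_distinct[OF E(1) e(1)] by auto
    hence "n < j \<or> j < n" by auto
    hence "j = Suc n \<or> n = Suc j"
      using no_chord[OF acyc p _ j(1) e(1)] no_chord[OF acyc p _ n(1) e(2)] by blast
    thus "y \<in> ?B" using j by auto
  qed
  have deg: "card (nbhd E u) \<noteq> 0" "card (nbhd E u) \<noteq> 1"
    using E(2) u by (auto simp: no_isolated_vertices_def inner_def vertex_degree_def)
  have n': "0 < n \<and> Suc n < length p"
  proof (rule ccontr)
    assume "\<not> (0 < n \<and> Suc n < length p)"
    then obtain z where "?B \<subseteq> {z}" by auto
    with sub have "nbhd E u \<subseteq> {z}" by blast
    hence "card (nbhd E u) \<le> 1" using card_mono[of "{z}" "nbhd E u"] by simp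
    with deg show False by linarith
  qed
  hence B: "?B = {p ! (n - 1), p ! Suc n}" by auto
  have le2: "card {p ! (n - 1), p ! Suc n} \<le> 2" by (simp add: card_insert_if)
  hence nb: "nbhd E u = {p ! (n - 1), p ! Suc n}"
    using sub deg card_seteq[of "{p ! (n - 1), p ! Suc n}" "nbhd E u"] unfolding B by force
  have "vertex_degree E u = 2"
    using deg le2 unfolding vertex_degree_def nb[symmetric] by linarith
  with that n n' nb show thesis by blast
qed

definition nbhd_rel :: "'v::finite set set \<Rightarrow> 'v \<Rightarrow> 'v \<Rightarrow> bool" where
  "nbhd_rel E u v \<longleftrightarrow> u \<noteq> v \<and> (\<exists>w\<in>inner E. u \<in> closed_nbhd E w \<and> v \<in> closed_nbhd E w)"

text \<open>The generators coming from a vertex \<open>i\<close> are the products over \<open>closed_nbhd E i\<close> with one factor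
  omitted. For a leaf they are its own variable and that of its neighbor. For a neighbor of a leaf
  they are multiples of one of these, since \<open>i\<close> and the leaf cannot both be omitted. For an inner
  vertex the neighborhood has three elements, so the generators are products of pairs.\<close>

lemma nbhd_mons_degree:
  assumes E: "simple_graph E" "no_isolated_vertices E"
    and deg2: "\<And>u. u \<in> inner E \<Longrightarrow> vertex_degree E u = 2"
  shows "nbhd_mons (vertex_degree E) E = pair_mons (nbhd_rel E) (inner E)"
proof (intro equalityI subsetI)
  fix a assume "a \<in> nbhd_mons (vertex_degree E) E"
  then obtain i W where W: "W \<subseteq> closed_nbhd E i" "card W = vertex_degree E i"
    and pos: "\<And>j. j \<in> W \<Longrightarrow> Poly_Mapping.lookup a j > 0"
    unfolding nbhd_mons_def by blast
  have off: "a \<in> pair_mons (nbhd_rel E) (inner E)" if "z \<in> W" "z \<notin> inner E" for z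
    unfolding pair_mons_def off_mons_def using that pos by blast
  show "a \<in> pair_mons (nbhd_rel E) (inner E)"
  proof (cases "vertex_degree E i = 1")
    case True
    with W obtain z where z: "W = {z}" by (auto simp: card_1_singleton_iff)
    hence "z = i \<or> i \<in> nbhd E z" using W by (auto simp: closed_nbhd_def nbhd_sym)
    hence "z \<notin> inner E" using True by (auto simp: inner_def)
    with off[of z] z show ?thesis by simp
  next
    case False
    show ?thesis
    proof (cases "i \<in> inner E")
      case True
      with W deg2 obtain u v where "W = {u, v}" "u \<noteq> v" by (auto simp: card_2_iff)
      hence "nbhd_rel E u v" using True W by (auto simp: nbhd_rel_def)
      thus ?thesis unfolding pair_mons_def using pos \<open>W = {u, v}\<close> by blast
    next
      case not_inner: False
      with False obtain l where l: "l \<in> nbhd E i" "vertex_degree E l = 1" by (auto simp: inner_def)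
      hence "l \<notin> inner E" by (simp add: inner_def)
      have "W \<inter> {i, l} \<noteq> {}"
      proof
        assume "W \<inter> {i, l} = {}"
        with W have "W \<subseteq> nbhd E i - {l}" by (auto simp: closed_nbhd_def)
        hence "card W \<le> card (nbhd E i - {l})" by (intro card_mono) simp_all
        also have "\<dots> < card (nbhd E i)" using l by (intro psubset_card_mono) auto
        finally show False using W by (simp add: vertex_degree_def)
      qed
      with off[of i] off[of l] not_inner \<open>l \<notin> inner E\<close> show ?thesis by blast
    qed
  qed
next
  fix a assume "a \<in> pair_mons (nbhd_rel E) (inner E)"
  then consider z where "z \<notin> inner E" "Poly_Mapping.lookup a z > 0"
    | u v where "nbhd_rel E u v" "Poly_Mapping.lookup a u > 0" "Poly_Mapping.lookup a v > 0"
    unfolding pair_mons_def off_mons_def by blast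
  thus "a \<in> nbhd_mons (vertex_degree E) E"
  proof cases
    case (1 z)
    then obtain i where "z \<in> closed_nbhd E i" "vertex_degree E i = 1"
      unfolding inner_def closed_nbhd_def using nbhd_sym[of _ E z] by blast
    with 1 show ?thesis
      unfolding nbhd_mons_def by (intro CollectI exI[of _ i] exI[of _ "{z}"]) simp
  next
    case (2 u v)
    then obtain w where "u \<noteq> v" "w \<in> inner E" "u \<in> closed_nbhd E w" "v \<in> closed_nbhd E w"
      by (auto simp: nbhd_rel_def)
    with 2 deg2[of w] show ?thesis
      unfolding nbhd_mons_def by (intro CollectI exI[of _ w] exI[of _ "{u, v}"]) simp
  qed
qed

text \<open>Partners are one or two steps apart on the spine. In the latter case the inner vertex whose
  neighborhood contains both is the one between them; in both cases the successor of the first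
  partner is inner.\<close>

lemma nbhd_rel_spine:
  assumes E: "simple_graph E" "no_isolated_vertices E" and acyc: "\<nexists>c. graph_cycle E c"
    and p: "graph_path E p"
    and dom: "\<forall>v. v \<in> set p \<or> (\<exists>u\<in>set p. {u, v} \<in> E)"
    and inner: "p ! i \<in> inner E" "p ! j \<in> inner E" and rel: "nbhd_rel E (p ! i) (p ! j)"
    and ij: "i < j" "j < length p"
  shows "p ! Suc i \<in> inner E \<and>
    (j = Suc i \<or> j = Suc (Suc i) \<and> p ! j \<in> closed_nbhd E (p ! Suc i))"
proof -
  from rel obtain w where w: "w \<in> inner E" "p ! i \<in> closed_nbhd E w" "p ! j \<in> closed_nbhd E w"
    by (auto simp: nbhd_rel_def)
  obtain m where m: "0 < m" "Suc m < length p" "w = p ! m" "nbhd E w = {p ! (m - 1), p ! Suc m}"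
    by (rule inner_on_spine[OF E acyc p dom w(1)])
  have "distinct p" using p by (simp add: graph_path_def)
  hence eq: "p ! k = p ! l \<longleftrightarrow> k = l" if "k < length p" "l < length p" for k l
    using that by (simp add: nth_eq_iff_index_eq)
  have "i \<in> {m - 1, m, Suc m}" "j \<in> {m - 1, m, Suc m}"
    using w(2,3) m ij by (auto simp: closed_nbhd_def eq)
  with m(1) ij have "i = m \<and> j = Suc m \<or> i = m - 1 \<and> j = m \<or> i = m - 1 \<and> j = Suc m"
    by auto
  thus ?thesis using m w inner by (elim disjE) auto
qed

text \<open>The budget \<open>f n\<close> counts the inner vertices of the cover from position \<open>n\<close> on. It drops because the
  spine edge from position \<open>n\<close> to \<open>n + 1\<close> is covered by one of its two inner ends.\<close>

lemma koszul_reg_le_caterpillar: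
  assumes E: "simple_graph E" "no_isolated_vertices E" and acyc: "\<nexists>c. graph_cycle E c"
    and p: "graph_path E p"
    and dom: "\<forall>v. v \<in> set p \<or> (\<exists>u\<in>set p. {u, v} \<in> E)" and C: "vertex_cover E C"
  shows "koszul_reg_le (mon_ideal (pair_mons (nbhd_rel E) (inner E)) :: ('v::finite, 'k::field) mpoly set)
    (card (C \<inter> inner E))"
proof -
  have dist: "distinct p" using p by (simp add: graph_path_def)
  define idx where "idx v = (SOME i. i < length p \<and> p ! i = v)" for v
  have idx: "idx v < length p" "p ! idx v = v" if "v \<in> set p" for v
  proof -
    have "\<exists>i. i < length p \<and> p ! i = v" using that by (simp add: in_set_conv_nth)
    hence "idx v < length p \<and> p ! idx v = v" unfolding idx_def by (rule someI_ex)
    thus "idx v < length p" "p ! idx v = v" by auto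
  qed
  have idx_nth: "idx (p ! i) = i" if "i < length p" for i
    using idx[of "p ! i"] that dist by (simp add: nth_eq_iff_index_eq)
  have spine: "u \<in> set p" if "u \<in> inner E" for u
    by (rule inner_on_spine[OF E acyc p dom that]) simp
  define f where "f n = card {v \<in> C \<inter> inner E. n \<le> idx v}" for n
  have rel: "p ! Suc (idx u) \<in> inner E" "Suc (idx u) < length p"
    "idx x = Suc (idx u) \<or> x \<in> closed_nbhd E (p ! Suc (idx u))"
    if "u \<in> inner E" "x \<in> inner E" "nbhd_rel E u x" "idx u < idx x" for u x
  proof -
    show "Suc (idx u) < length p" using that(4) idx(1)[OF spine[OF that(2)]] by simp
    show "p ! Suc (idx u) \<in> inner E"
      "idx x = Suc (idx u) \<or> x \<in> closed_nbhd E (p ! Suc (idx u))"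
      using nbhd_rel_spine[OF E acyc p dom, of "idx u" "idx x"] that idx[OF spine] by auto
  qed
  have "koszul_reg_le (mon_ideal (pair_mons (nbhd_rel E) (inner E)) :: ('v, 'k) mpoly set) (f 0)"
  proof (rule koszul_reg_le_pair_mons[where idx = idx and U = "inner E" and f = f and n = 0])
    show "symp (nbhd_rel E)" by (rule sympI) (auto simp: nbhd_rel_def)
    show "irreflp (nbhd_rel E)" by (rule irreflpI) (simp add: nbhd_rel_def)
    show "inj_on idx (inner E)" by (rule inj_onI) (metis idx(2) spine)
    have "f n \<le> f m" if "m \<le> n" for m n
      unfolding f_def by (rule card_mono) (use that in auto)
    thus "antimono f" unfolding antimono_def by blast
  next
    fix u x assume ux: "u \<in> inner E" "x \<in> inner E" "nbhd_rel E u x" "idx u < idx x"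
    note * = rel[OF ux]
    have "{p ! idx u, p ! Suc (idx u)} \<in> E"
      using p *(2) by (simp add: graph_path_def successively_conv_nth)
    hence "{u, p ! Suc (idx u)} \<in> E" by (simp only: idx(2)[OF spine[OF ux(1)]])
    hence "{u, p ! Suc (idx u)} \<inter> C \<noteq> {}" using C unfolding vertex_cover_def by blast
    then obtain c where "c \<in> C" "c \<in> inner E" "idx u \<le> idx c" "idx c < idx u + 2"
      using ux(1) *(1) idx_nth[OF *(2)] by auto
    hence "c \<in> {v \<in> C \<inter> inner E. idx u \<le> idx v} - {v \<in> C \<inter> inner E. idx u + 2 \<le> idx v}"
      by simp
    moreover have "{v \<in> C \<inter> inner E. idx u + 2 \<le> idx v} \<subseteq> {v \<in> C \<inter> inner E. idx u \<le> idx v}"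
      by auto
    ultimately have "{v \<in> C \<inter> inner E. idx u + 2 \<le> idx v} \<subset> {v \<in> C \<inter> inner E. idx u \<le> idx v}"
      by blast
    thus "f (idx u + 2) < f (idx u)" unfolding f_def by (intro psubset_card_mono) simp_all
  next
    fix u x y assume ux: "u \<in> inner E" "x \<in> inner E" "nbhd_rel E u x" "idx u < idx x"
      and y: "y \<in> inner E" "idx y = idx u + 1"
    have "y = p ! Suc (idx u)" using y(2) idx(2)[OF spine[OF y(1)]] by simp
    with rel(3)[OF ux] have "idx x = idx y \<or> x \<in> closed_nbhd E y" using y(2) by auto
    thus "y = x \<or> nbhd_rel E x y"
    proof
      assume "idx x = idx y"
      with idx(2)[OF spine[OF y(1)]] idx(2)[OF spine[OF ux(2)]] show ?thesis by simp
    next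
      assume "x \<in> closed_nbhd E y"
      with y(1) show ?thesis by (auto simp: nbhd_rel_def closed_nbhd_def)
    qed
  qed simp_all
  thus ?thesis by (simp add: f_def Int_def)
qed

text \<open>The first vertex of the spine has no predecessor, so it is not inner: it is a leaf or adjacent to
  one. Hence there is a leaf, and the edge at that leaf has no inner end but must be covered.\<close>

lemma vertex_cover_not_inner:
  assumes E: "simple_graph E" "no_isolated_vertices E" and acyc: "\<nexists>c. graph_cycle E c"
    and p: "graph_path E p"
    and dom: "\<forall>v. v \<in> set p \<or> (\<exists>u\<in>set p. {u, v} \<in> E)" and C: "vertex_cover E C"
  shows "card (C \<inter> inner E) < card C"
proof -
  have "distinct p" using p by (simp add: graph_path_def)
  have start: "p ! 0 \<notin> inner E"
  proof
    assume "p ! 0 \<in> inner E"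
    then obtain n where n: "0 < n" "Suc n < length p" "p ! 0 = p ! n"
      by (rule inner_on_spine[OF E acyc p dom])
    hence "0 < length p" "n < length p" by linarith+
    from nth_eq_iff_index_eq[OF \<open>distinct p\<close> this] n show False by simp
  qed
  obtain u v where uv: "v \<in> nbhd E u" "vertex_degree E u = 1"
  proof (cases "vertex_degree E (p ! 0) = 1")
    case True
    moreover obtain v where "v \<in> nbhd E (p ! 0)"
      using E(2) unfolding no_isolated_vertices_def by blast
    ultimately show thesis by (intro that)
  next
    case False
    with start obtain u where "u \<in> nbhd E (p ! 0)" "vertex_degree E u = 1"
      unfolding inner_def by blast
    thus thesis by (intro that[of "p ! 0" u]) (simp_all add: nbhd_sym[of _ E u])
  qed
  hence "u \<notin> inner E" "v \<notin> inner E" by (auto simp: inner_def nbhd_sym)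
  moreover have "{u, v} \<inter> C \<noteq> {}" using C uv unfolding vertex_cover_def nbhd_def by blast
  ultimately show ?thesis by (intro psubset_card_mono) auto
qed

theorem theorem3p5:
  fixes E :: "'v::finite set set"
  assumes "simple_graph E"
    and "caterpillar E"
    and "no_isolated_vertices E"
  shows "reg_quotient (neighborhood_ideal (vertex_degree E) E :: ('v, 'k::field) mpoly set)
           \<le> ereal (real (vertex_cover_number E) - 1)"
proof -
  note E = assms(1,3)
  from assms(2) obtain p where acyc: "\<nexists>c. graph_cycle E c" and p: "graph_path E p"
    and dom: "\<forall>v. v \<in> set p \<or> (\<exists>u\<in>set p. {u, v} \<in> E)"
    unfolding caterpillar_def is_tree_def by blast
  have "vertex_cover E UNIV" using E(1) by (auto simp: vertex_cover_def simple_graph_def)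
  hence "vertex_cover_number E \<in> card ` {C. vertex_cover E C}"
    unfolding vertex_cover_number_def by (intro Min_in) auto
  then obtain C where C: "vertex_cover E C" "vertex_cover_number E = card C" by blast
  let ?M = "pair_mons (nbhd_rel E) (inner E)"
  have "vertex_degree E u = 2" if "u \<in> inner E" for u
    by (rule inner_on_spine[OF E acyc p dom that])
  hence "neighborhood_ideal (vertex_degree E) E = (mon_ideal ?M :: ('v, 'k) mpoly set)"
    by (simp add: neighborhood_ideal_eq nbhd_mons_degree[OF E])
  moreover have "reg_quotient (mon_ideal ?M :: ('v, 'k) mpoly set) \<le> ereal (real (card (C \<inter> inner E)))"
    by (intro reg_quotient_le_koszul mult_closed_pair_mons
        koszul_reg_le_caterpillar[OF E acyc p dom C(1)])
  moreover have "real (card (C \<inter> inner E)) \<le> real (vertex_cover_number E) - 1"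
    using vertex_cover_not_inner[OF E acyc p dom C(1)] C(2) by simp
  ultimately show ?thesis by (metis ereal_less_eq(3) order_trans)
qed

end
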